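(* Let $d\in\mathbb N$, $\mathcal D=\{1,\dots,d\}$, $w:\mathbb Z^d\to[1,\infty)$ a weight function, $\delta\in(0,1)$, and $f\in\mathrm H^w(\mathbb T^d)$. Let $d^{\mathrm{sup}}_\delta$ be the superposition dimension of $\mathrm H^w(\mathbb T^d)$ for $\delta$. If there exists a subset of ANOVA terms $U\subseteq U_{d^{\mathrm{sup}}_\delta}$ and $\varepsilon>0$ such that $\varrho(\mathbf u,f)<\varepsilon$ for every $\mathbf u\in U_{d^{\mathrm{sup}}_\delta}\setminus U$, then $$\frac{\|f-\mathrm T_Uf\|_{\mathrm L_2(\mathbb T^d)}}{\|f\|_{\mathrm H^w(\mathbb T^d)}}\le\sqrt{1-\delta}+\sqrt{|U_{d^{\mathrm{sup}}_\delta}\setminus U|\,\varepsilon}.$$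
   Context: $\mathbb T=[0,1)$ with periodic identification; $c_{\mathbf k}(g)$ Fourier coefficients. $\mathrm H^w(\mathbb T^d)=\{g\in\mathrm L_2:\|g\|_{\mathrm H^w}=(\sum_{\mathbf k}w(\mathbf k)^2|c_{\mathbf k}(g)|^2)^{1/2}<\infty\}$. For $\mathbf u\subseteq\mathcal D$: $\mathrm P_{\mathbf u}g(\mathbf x_{\mathbf u})=\int_{\mathbb T^{|\mathcal D\setminus\mathbf u|}}g(\mathbf x)\,d\mathbf x_{\mathcal D\setminus\mathbf u}$, ANOVA terms $g_{\mathbf u}=\mathrm P_{\mathbf u}g-\sum_{\mathbf v\subsetneq\mathbf u}g_{\mathbf v}$ (recursively). Variance $\sigma^2(g)=\|g\|_{\mathrm L_2}^2-|c_{\mathbf 0}(g)|^2$; global sensitivity index $\varrho(\mathbf u,g)=\sigma^2(g_{\mathbf u})/\sigma^2(g)$. $U_s=\{\mathbf u\subseteq\mathcal D:|\mathbf u|\le s\}$. Superposition dimension: $d^{\mathrm{sup}}_\delta=\min\{s\in\mathcal D:\sup_{g\in\mathrm H^w,\|g\|_{\mathrm H^w}\le1}\sum_{\mathbf u\subseteq\mathcal D,|\mathbf u|>s}\|g_{\mathbf u}\|^2_{\mathrm L_2}\le1-\delta\}$. A subset of ANOVA terms is a $U\subseteq\mathcal P(\mathcal D)$ closed under taking subsets; $\mathrm T_Uf=\sum_{\mathbf u\in U}f_{\mathbf u}$.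
   Formalization: The formal theorem additionally assumes U is nonempty, i.e. U contains the empty set (the constant ANOVA term); for empty U the claim is false, since ϱ(∅,f)=0 never controls the mean of f. *)

theory Defs
  imports "HOL-Analysis.Analysis"
begin

text \<open>Index set D = {1..d}; points of T^d are extensional functions nat => real
  on D with values in [0,1); frequencies k in Z^d are functions nat => int vanishing
  outside D.\<close>

definition Dset :: "nat \<Rightarrow> nat set" where
  "Dset d = {1..d}"

definition Zd :: "nat \<Rightarrow> (nat \<Rightarrow> int) set" where
  "Zd d = {k. \<forall>j. j \<notin> Dset d \<longrightarrow> k j = 0}"

definition TorOn :: "nat set \<Rightarrow> (nat \<Rightarrow> real) measure" where
  "TorOn I = PiM I (\<lambda>_. restrict_space lborel {0..<1::real})"

abbreviation Tor :: "nat \<Rightarrow> (nat \<Rightarrow> real) measure" where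
  "Tor d \<equiv> TorOn (Dset d)"

definition fourier :: "nat \<Rightarrow> ((nat \<Rightarrow> real) \<Rightarrow> complex) \<Rightarrow> (nat \<Rightarrow> int) \<Rightarrow> complex" where
  "fourier d g k = (LINT x|Tor d. g x * exp (- 2 * of_real pi * \<i> *
       of_real (\<Sum>j\<in>Dset d. of_int (k j) * x j)))"

definition L2 :: "nat \<Rightarrow> ((nat \<Rightarrow> real) \<Rightarrow> complex) set" where
  "L2 d = {g. g \<in> borel_measurable (Tor d) \<and> integrable (Tor d) (\<lambda>x. (cmod (g x))\<^sup>2)}"

definition L2norm :: "nat \<Rightarrow> ((nat \<Rightarrow> real) \<Rightarrow> complex) \<Rightarrow> real" where
  "L2norm d g = sqrt (LINT x|Tor d. (cmod (g x))\<^sup>2)"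

definition Hw :: "nat \<Rightarrow> ((nat \<Rightarrow> int) \<Rightarrow> real) \<Rightarrow> ((nat \<Rightarrow> real) \<Rightarrow> complex) set" where
  "Hw d w = {g. g \<in> L2 d \<and> (\<lambda>k. (w k)\<^sup>2 * (cmod (fourier d g k))\<^sup>2) summable_on Zd d}"

definition Hnorm :: "nat \<Rightarrow> ((nat \<Rightarrow> int) \<Rightarrow> real) \<Rightarrow> ((nat \<Rightarrow> real) \<Rightarrow> complex) \<Rightarrow> real" where
  "Hnorm d w g = sqrt (\<Sum>\<^sub>\<infinity>k\<in>Zd d. (w k)\<^sup>2 * (cmod (fourier d g k))\<^sup>2)"

text \<open>Projection P_u g: integrate out the variables in D \ u (result regarded as
  a function on T^d depending only on x_u).\<close>
definition Proj :: "nat \<Rightarrow> nat set \<Rightarrow> ((nat \<Rightarrow> real) \<Rightarrow> complex) \<Rightarrow> (nat \<Rightarrow> real) \<Rightarrow> complex" where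
  "Proj d u g x = (LINT y|TorOn (Dset d - u). g (merge u (Dset d - u) (x, y)))"

function anova :: "nat \<Rightarrow> ((nat \<Rightarrow> real) \<Rightarrow> complex) \<Rightarrow> nat set \<Rightarrow> (nat \<Rightarrow> real) \<Rightarrow> complex" where
  "anova d g u x = (if finite u then Proj d u g x - (\<Sum>v\<in>{v. v \<subset> u}. anova d g v x) else 0)"
  by auto
termination
  by (relation "Wellfounded.measure (\<lambda>(d, g, u, x). card u)") (auto intro: psubset_card_mono)

definition variance :: "nat \<Rightarrow> ((nat \<Rightarrow> real) \<Rightarrow> complex) \<Rightarrow> real" where
  "variance d g = (L2norm d g)\<^sup>2 - (cmod (fourier d g (\<lambda>_. 0)))\<^sup>2"

definition gsi :: "nat \<Rightarrow> nat set \<Rightarrow> ((nat \<Rightarrow> real) \<Rightarrow> complex) \<Rightarrow> real" where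
  "gsi d u g = variance d (anova d g u) / variance d g"

definition Us :: "nat \<Rightarrow> nat \<Rightarrow> nat set set" where
  "Us d s = {u. u \<subseteq> Dset d \<and> card u \<le> s}"

definition dsup :: "nat \<Rightarrow> ((nat \<Rightarrow> int) \<Rightarrow> real) \<Rightarrow> real \<Rightarrow> nat" where
  "dsup d w \<delta> = (LEAST s. s \<in> Dset d \<and>
     Sup {(\<Sum>u\<in>{u. u \<subseteq> Dset d \<and> card u > s}. (L2norm d (anova d g u))\<^sup>2) | g.
            g \<in> Hw d w \<and> Hnorm d w g \<le> 1} \<le> 1 - \<delta>)"

definition anova_subset :: "nat \<Rightarrow> nat set set \<Rightarrow> bool" where
  "anova_subset d U \<longleftrightarrow> U \<subseteq> Pow (Dset d) \<and> (\<forall>u\<in>U. \<forall>v. v \<subseteq> u \<longrightarrow> v \<in> U)"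

definition TU :: "nat \<Rightarrow> nat set set \<Rightarrow> ((nat \<Rightarrow> real) \<Rightarrow> complex) \<Rightarrow> (nat \<Rightarrow> real) \<Rightarrow> complex" where
  "TU d U f x = (\<Sum>u\<in>U. anova d f u x)"

end

theory Submission
  imports Defs "HOL-Probability.Infinite_Product_Measure"
begin

text \<open>The ANOVA term \<open>f\<^sub>u\<close> retains exactly the Fourier coefficients of \<open>f\<close> whose frequency has support
  \<open>u\<close>. By Parseval, \<open>\<parallel>f - T\<^sub>U f\<parallel>\<^sup>2\<close> is therefore the sum of \<open>\<parallel>f\<^sub>u\<parallel>\<^sup>2\<close> over \<open>u \<notin> U\<close>. The terms of order above
  the superposition dimension contribute at most \<open>(1 - \<delta>) \<parallel>f\<parallel>\<^sup>2\<close> (norm of \<open>H\<^sup>w\<close>) by scaling \<open>f\<close> to the unit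
  ball, and each remaining term at most \<open>\<epsilon> \<sigma>\<^sup>2(f) \<le> \<epsilon> \<parallel>f\<parallel>\<^sup>2\<close>, since \<open>w \<ge> 1\<close>.

  Parseval on the torus reduces to approximating indicators of products of closed subsets of the
  circle: these are bounded pointwise limits of products of continuous functions on the circle,
  which are uniform limits of trigonometric polynomials by Stone-Weierstrass.\<close>

subsection \<open>Parseval for bounded orthonormal families\<close>

text \<open>Passing to Fourier coefficients turns the recursively defined terms into disjoint blocks
  of frequencies, so no cross terms or inclusion-exclusion sums have to be estimated: error,
  variance and tail are all finite sums of the block energies \<open>energy d f u\<close>. The one
  analytic obstacle is that an arbitrary \<open>L2\<close> function loses no norm in its
  coefficients. Completeness is therefore isolated in a predicate on single functions,
  \<open>approximable\<close>, whose key closure property is dominated convergence. Closed sets of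
  the circle, rather than intervals of [0,1), generate the sigma-algebra because only functions that
  match at the two ends of [0,1) are uniform limits of trigonometric polynomials. The constant term
  needs care: its sensitivity index is always 0, so a small index says nothing about its norm, and
  it has to belong to \<open>U\<close>. Orthogonality yields the bound sqrt((1 - \<delta>) + n
  \<epsilon>), with n the number of omitted low-order terms; the stated sum of two roots follows
  from subadditivity of the square root.\<close>

definition square_integrable :: "'a measure \<Rightarrow> ('a \<Rightarrow> complex) \<Rightarrow> bool" where
  "square_integrable M g \<longleftrightarrow> g \<in> borel_measurable M \<and> integrable M (\<lambda>x. (cmod (g x))\<^sup>2)"

lemma square_integrable_measurable [measurable_dest]:
  "square_integrable M g \<Longrightarrow> g \<in> borel_measurable M"
  by (simp add: square_integrable_def)

text \<open>A substitute for Minkowski's inequality: it lets L2 distances stay squared integrals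
  throughout, at the price of a factor 2 per triangle inequality.\<close>

lemma cmod_add_squared_le: "(cmod (a + b))\<^sup>2 \<le> 2 * (cmod a)\<^sup>2 + 2 * (cmod b)\<^sup>2"
proof -
  have "(cmod (a + b))\<^sup>2 \<le> (cmod a + cmod b)\<^sup>2"
    by (intro power_mono norm_triangle_ineq) auto
  also have "\<dots> \<le> 2 * (cmod a)\<^sup>2 + 2 * (cmod b)\<^sup>2"
    using sum_squares_bound[of "cmod a" "cmod b"] by (simp add: power2_sum)
  finally show ?thesis .
qed

text \<open>The cross term is grouped so that integrating it in \<open>sqdist_subtract_e\<close>
  exposes \<open>coeff\<close>; the case \<open>w = 1\<close> serves there again to complete the
  square.\<close>

lemma cmod_diff_squared_expand:
  "(cmod (z - a * w))\<^sup>2 = (cmod z)\<^sup>2 - 2 * Re (cnj a * (z * cnj w)) + (cmod a)\<^sup>2 * (cmod w)\<^sup>2"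
  unfolding cmod_power2 by (simp add: power2_eq_square algebra_simps)

lemma square_integrable_mult:
  assumes f: "square_integrable M f" and c: "c \<in> borel_measurable M"
    and b: "\<And>x. x \<in> space M \<Longrightarrow> cmod (c x) \<le> B"
  shows "square_integrable M (\<lambda>x. c x * f x)"
proof -
  note [measurable] = f c
  have "integrable M (\<lambda>x. B\<^sup>2 * (cmod (f x))\<^sup>2)"
    using f by (simp add: square_integrable_def)
  then have "integrable M (\<lambda>x. (cmod (c x * f x))\<^sup>2)"
  proof (rule Bochner_Integration.integrable_bound)
    show "AE x in M. norm ((cmod (c x * f x))\<^sup>2) \<le> norm (B\<^sup>2 * (cmod (f x))\<^sup>2)"
      by (intro AE_I2) (auto simp: norm_mult power_mult_distrib intro!: mult_right_mono power_mono b)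
  qed measurable
  then show ?thesis
    by (simp add: square_integrable_def)
qed

lemma square_integrable_cmult:
  "square_integrable M f \<Longrightarrow> square_integrable M (\<lambda>x. a * f x)"
  by (rule square_integrable_mult[where B = "cmod a"]) auto

lemma square_integrable_add:
  assumes f: "square_integrable M f" and g: "square_integrable M g"
  shows "square_integrable M (\<lambda>x. f x + g x)"
proof -
  note [measurable] = f g
  have "integrable M (\<lambda>x. 2 * (cmod (f x))\<^sup>2 + 2 * (cmod (g x))\<^sup>2)"
    using f g by (simp add: square_integrable_def)
  then have "integrable M (\<lambda>x. (cmod (f x + g x))\<^sup>2)"
    by (rule Bochner_Integration.integrable_bound)
       (auto intro!: AE_I2 order.trans[OF cmod_add_squared_le])
  then show ?thesis
    by (simp add: square_integrable_def)
qed

lemma square_integrable_diff: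
  "square_integrable M f \<Longrightarrow> square_integrable M g \<Longrightarrow> square_integrable M (\<lambda>x. f x - g x)"
  using square_integrable_add[of M f "\<lambda>x. -1 * g x"] square_integrable_cmult[of M g "-1"] by simp

lemma square_integrable_sum:
  "(\<And>i. i \<in> I \<Longrightarrow> square_integrable M (f i)) \<Longrightarrow> square_integrable M (\<lambda>x. \<Sum>i\<in>I. f i x)"
  by (induction I rule: infinite_finite_induct)
     (auto intro: square_integrable_add simp: square_integrable_def[of M "\<lambda>_. 0"])

lemma square_integrable_integrable_mult:
  assumes f: "square_integrable M f" and g: "square_integrable M g"
  shows "integrable M (\<lambda>x. f x * g x)"
proof -
  note [measurable] = f g
  have "integrable M (\<lambda>x. (cmod (f x))\<^sup>2 + (cmod (g x))\<^sup>2)"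
    using f g by (simp add: square_integrable_def)
  then show ?thesis
  proof (rule Bochner_Integration.integrable_bound)
    show "AE x in M. norm (f x * g x) \<le> norm ((cmod (f x))\<^sup>2 + (cmod (g x))\<^sup>2)"
    proof (intro AE_I2)
      fix x
      show "norm (f x * g x) \<le> norm ((cmod (f x))\<^sup>2 + (cmod (g x))\<^sup>2)"
        using sum_squares_bound[of "cmod (f x)" "cmod (g x)"]
          mult_nonneg_nonneg[OF norm_ge_zero norm_ge_zero, of "f x" "g x"]
        unfolding real_norm_def norm_mult by linarith
    qed
  qed measurable
qed

lemma (in finite_measure) square_integrable_bounded:
  assumes [measurable]: "f \<in> borel_measurable M" and b: "\<And>x. x \<in> space M \<Longrightarrow> cmod (f x) \<le> B"
  shows "square_integrable M f"
  unfolding square_integrable_def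
proof
  show "integrable M (\<lambda>x. (cmod (f x))\<^sup>2)"
    by (rule integrable_const_bound[where B = "B\<^sup>2"]) (auto intro!: AE_I2 power_mono b)
qed measurable

text \<open>Completeness of the family is not part of the locale; it enters one function at a time
  through \<open>approximable\<close>. The pointwise bound makes every \<open>e k\<close>
  square-integrable on the probability space.\<close>

locale bounded_orthonormal = prob_space M for M :: "'a measure" +
  fixes e :: "'k \<Rightarrow> 'a \<Rightarrow> complex" and K :: "'k set"
  assumes e_measurable: "k \<in> K \<Longrightarrow> e k \<in> borel_measurable M"
    and e_bounded: "k \<in> K \<Longrightarrow> cmod (e k x) \<le> 1"
    and orthonormal: "k \<in> K \<Longrightarrow> l \<in> K \<Longrightarrow>
          (\<integral>x. e k x * cnj (e l x) \<partial>M) = (if k = l then 1 else 0)"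
begin

definition coeff :: "('a \<Rightarrow> complex) \<Rightarrow> 'k \<Rightarrow> complex" where
  "coeff g k = (\<integral>x. g x * cnj (e k x) \<partial>M)"

definition sqdist :: "('a \<Rightarrow> complex) \<Rightarrow> ('a \<Rightarrow> complex) \<Rightarrow> real" where
  "sqdist g h = (\<integral>x. (cmod (g x - h x))\<^sup>2 \<partial>M)"

text \<open>Membership in the mean-square closure of the linear span of the
  \<open>e k\<close>.\<close>

definition approximable :: "('a \<Rightarrow> complex) \<Rightarrow> bool" where
  "approximable g \<longleftrightarrow> square_integrable M g \<and>
     (\<forall>\<epsilon>>0. \<exists>F a. finite F \<and> F \<subseteq> K \<and> sqdist g (\<lambda>x. \<Sum>k\<in>F. a k * e k x) < \<epsilon>)"

lemma square_integrable_e: "k \<in> K \<Longrightarrow> square_integrable M (e k)"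
  by (rule square_integrable_bounded[where B = 1]) (auto simp: e_measurable e_bounded)

lemma square_integrable_cnj_e: "k \<in> K \<Longrightarrow> square_integrable M (\<lambda>x. cnj (e k x))"
  using square_integrable_e[of k] unfolding square_integrable_def
  by (auto intro: borel_measurable_continuous_onI[THEN measurable_compose_rev] continuous_intros)

lemma square_integrable_span: "F \<subseteq> K \<Longrightarrow> square_integrable M (\<lambda>x. \<Sum>k\<in>F. a k * e k x)"
  by (intro square_integrable_sum square_integrable_cmult square_integrable_e) auto

lemma integrable_coeff:
  "square_integrable M g \<Longrightarrow> k \<in> K \<Longrightarrow> integrable M (\<lambda>x. g x * cnj (e k x))"
  by (intro square_integrable_integrable_mult square_integrable_cnj_e)

lemma coeff_diff:
  assumes "square_integrable M g" "square_integrable M h" "k \<in> K"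
  shows "coeff (\<lambda>x. g x - h x) k = coeff g k - coeff h k"
  unfolding coeff_def left_diff_distrib
  by (intro Bochner_Integration.integral_diff integrable_coeff assms)

lemma coeff_cmult: "coeff (\<lambda>x. a * g x) k = a * coeff g k"
  by (simp add: coeff_def mult.assoc)

lemma coeff_sum:
  assumes "\<And>i. i \<in> I \<Longrightarrow> square_integrable M (h i)" "k \<in> K"
  shows "coeff (\<lambda>x. \<Sum>i\<in>I. h i x) k = (\<Sum>i\<in>I. coeff (h i) k)"
  unfolding coeff_def sum_distrib_right
  by (intro Bochner_Integration.integral_sum integrable_coeff assms)

lemma coeff_e: "k \<in> K \<Longrightarrow> l \<in> K \<Longrightarrow> coeff (e l) k = (if l = k then 1 else 0)"
  by (simp add: coeff_def orthonormal)

section \<open>Pythagoras, Bessel and Parseval\<close>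

lemma integral_cmod_e_squared: "k \<in> K \<Longrightarrow> (\<integral>x. (cmod (e k x))\<^sup>2 \<partial>M) = 1"
proof -
  assume "k \<in> K"
  have "complex_of_real (\<integral>x. (cmod (e k x))\<^sup>2 \<partial>M) = (\<integral>x. e k x * cnj (e k x) \<partial>M)"
    by (simp add: complex_norm_square[symmetric] flip: integral_complex_of_real)
  also have "\<dots> = 1"
    using orthonormal[OF \<open>k \<in> K\<close> \<open>k \<in> K\<close>] by simp
  finally show ?thesis
    using of_real_eq_1_iff by blast
qed

text \<open>Completing the square: with c = \<open>coeff g k\<close>, the linear and quadratic terms
  in \<open>a\<close> add up to |c - a|^2 - |c|^2.\<close>

lemma sqdist_subtract_e:
  assumes g: "square_integrable M g" and k: "k \<in> K"
  shows "(\<integral>x. (cmod (g x - a * e k x))\<^sup>2 \<partial>M)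
    = (\<integral>x. (cmod (g x))\<^sup>2 \<partial>M) - (cmod (coeff g k))\<^sup>2 + (cmod (coeff g k - a))\<^sup>2"
proof -
  have 1: "integrable M (\<lambda>x. (cmod (g x))\<^sup>2)"
    using g by (simp add: square_integrable_def)
  have 2: "integrable M (\<lambda>x. cnj a * (g x * cnj (e k x)))"
    using integrable_coeff[OF g k] by simp
  have int_Re: "integrable M (\<lambda>x. 2 * Re (cnj a * (g x * cnj (e k x))))"
    by (rule integrable_mult_right[OF integrable_Re[OF 2]])
  have 3: "integrable M (\<lambda>x. (cmod a)\<^sup>2 * (cmod (e k x))\<^sup>2)"
    using square_integrable_e[OF k] by (simp add: square_integrable_def)
  have "(\<integral>x. (cmod (g x - a * e k x))\<^sup>2 \<partial>M)
      = (\<integral>x. (cmod (g x))\<^sup>2 \<partial>M) - 2 * Re (cnj a * coeff g k) + (cmod a)\<^sup>2"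
  proof -
    have "(\<integral>x. (cmod (g x - a * e k x))\<^sup>2 \<partial>M)
        = (\<integral>x. (cmod (g x))\<^sup>2 - 2 * Re (cnj a * (g x * cnj (e k x))) + (cmod a)\<^sup>2 * (cmod (e k x))\<^sup>2 \<partial>M)"
      unfolding cmod_diff_squared_expand ..
    also have "\<dots> = (\<integral>x. (cmod (g x))\<^sup>2 \<partial>M) - 2 * (\<integral>x. Re (cnj a * (g x * cnj (e k x))) \<partial>M)
        + (cmod a)\<^sup>2 * (\<integral>x. (cmod (e k x))\<^sup>2 \<partial>M)"
      by (simp only: Bochner_Integration.integral_add[OF Bochner_Integration.integrable_diff[OF 1 int_Re] 3]
          Bochner_Integration.integral_diff[OF 1 int_Re] integral_mult_right_zero)
    also have "(\<integral>x. Re (cnj a * (g x * cnj (e k x))) \<partial>M) = Re (cnj a * coeff g k)"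
      unfolding coeff_def integral_Re[OF 2] by simp
    finally show ?thesis
      by (simp only: integral_cmod_e_squared[OF k] mult_1_right)
  qed
  then show ?thesis
    using cmod_diff_squared_expand[of "coeff g k" a 1] by simp
qed

text \<open>Pythagoras for arbitrary coefficients \<open>a\<close>. Choosing the Fourier
  coefficients gives Bessel's inequality; for any other choice the last sum is a nonnegative
  penalty, so a good approximation bounds the missing norm.\<close>

lemma sqdist_span:
  assumes g: "square_integrable M g" and F: "finite F" "F \<subseteq> K"
  shows "sqdist g (\<lambda>x. \<Sum>k\<in>F. a k * e k x)
    = (\<integral>x. (cmod (g x))\<^sup>2 \<partial>M) - (\<Sum>k\<in>F. (cmod (coeff g k))\<^sup>2) + (\<Sum>k\<in>F. (cmod (coeff g k - a k))\<^sup>2)"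
  using F
proof (induction F rule: finite_induct)
  case empty
  then show ?case by (simp add: sqdist_def)
next
  case (insert l F)
  define h where "h x = g x - (\<Sum>k\<in>F. a k * e k x)" for x
  have l: "l \<in> K" and FK: "F \<subseteq> K" using insert.prems by auto
  have h: "square_integrable M h"
    unfolding h_def by (intro square_integrable_diff g square_integrable_span FK)
  \<comment> \<open>Since \<open>l\<close> is not in \<open>F\<close>, orthonormality makes the
    subtracted part invisible to the coefficient at \<open>l\<close>.\<close>
  have "coeff h l = coeff g l - (\<Sum>k\<in>F. a k * coeff (e k) l)"
  proof -
    have "coeff h l = coeff g l - coeff (\<lambda>x. \<Sum>k\<in>F. a k * e k x) l"
      unfolding h_def by (rule coeff_diff[OF g square_integrable_span[OF FK] l])
    also have "coeff (\<lambda>x. \<Sum>k\<in>F. a k * e k x) l = (\<Sum>k\<in>F. a k * coeff (e k) l)"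
      using FK l
      by (subst coeff_sum) (auto simp: coeff_cmult intro!: square_integrable_cmult square_integrable_e)
    finally show ?thesis .
  qed
  also have "(\<Sum>k\<in>F. a k * coeff (e k) l) = 0"
  proof (rule sum.neutral, rule ballI)
    fix k assume "k \<in> F"
    with FK l insert.hyps(2) show "a k * coeff (e k) l = 0"
      using coeff_e[of l k] by (auto split: if_splits)
  qed
  finally have c: "coeff h l = coeff g l" by simp
  have "sqdist g (\<lambda>x. \<Sum>k\<in>insert l F. a k * e k x) = (\<integral>x. (cmod (h x - a l * e l x))\<^sup>2 \<partial>M)"
    using insert.hyps by (simp add: sqdist_def h_def algebra_simps)
  also have "\<dots> = sqdist g (\<lambda>x. \<Sum>k\<in>F. a k * e k x) - (cmod (coeff g l))\<^sup>2 + (cmod (coeff g l - a l))\<^sup>2"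
    by (subst sqdist_subtract_e[OF h l]) (simp add: c sqdist_def h_def)
  finally show ?case
    using insert by simp
qed

lemma bessel:
  assumes g: "square_integrable M g" and F: "finite F" "F \<subseteq> K"
  shows "(\<Sum>k\<in>F. (cmod (coeff g k))\<^sup>2) \<le> (\<integral>x. (cmod (g x))\<^sup>2 \<partial>M)"
proof -
  have "0 \<le> sqdist g (\<lambda>x. \<Sum>k\<in>F. coeff g k * e k x)"
    by (simp add: sqdist_def)
  then show ?thesis
    by (simp add: sqdist_span[OF g F])
qed

text \<open>Once \<open>Y\<close> contains the index set \<open>F\<close> of an
  \<epsilon>-approximation, \<open>sqdist_span\<close> puts the sum over \<open>F\<close>, hence the
  one over \<open>Y\<close>, above the squared norm minus \<epsilon>; Bessel bounds it from
  above.\<close>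

lemma parseval:
  assumes "approximable g"
  shows "((\<lambda>k. (cmod (coeff g k))\<^sup>2) has_sum (\<integral>x. (cmod (g x))\<^sup>2 \<partial>M)) K"
  unfolding has_sum_def
proof (rule tendstoI)
  fix \<epsilon> :: real assume "\<epsilon> > 0"
  have g: "square_integrable M g" using assms by (simp add: approximable_def)
  obtain F a where F: "finite F" "F \<subseteq> K" and lt: "sqdist g (\<lambda>x. \<Sum>k\<in>F. a k * e k x) < \<epsilon>"
    using assms \<open>\<epsilon> > 0\<close> by (auto simp: approximable_def)
  show "\<forall>\<^sub>F Y in finite_subsets_at_top K.
      dist (\<Sum>k\<in>Y. (cmod (coeff g k))\<^sup>2) (\<integral>x. (cmod (g x))\<^sup>2 \<partial>M) < \<epsilon>"
    unfolding eventually_finite_subsets_at_top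
  proof (intro exI[of _ F] conjI allI impI F)
    fix Y assume Y: "finite Y \<and> F \<subseteq> Y \<and> Y \<subseteq> K"
    have "(\<Sum>k\<in>F. (cmod (coeff g k))\<^sup>2) \<le> (\<Sum>k\<in>Y. (cmod (coeff g k))\<^sup>2)"
      using Y by (intro sum_mono2) auto
    moreover have "(\<Sum>k\<in>Y. (cmod (coeff g k))\<^sup>2) \<le> (\<integral>x. (cmod (g x))\<^sup>2 \<partial>M)"
      using Y by (intro bessel g) auto
    moreover have "0 \<le> (\<Sum>k\<in>F. (cmod (coeff g k - a k))\<^sup>2)"
      by (intro sum_nonneg) auto
    ultimately show "dist (\<Sum>k\<in>Y. (cmod (coeff g k))\<^sup>2) (\<integral>x. (cmod (g x))\<^sup>2 \<partial>M) < \<epsilon>"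
      using lt by (simp add: sqdist_span[OF g F] dist_real_def)
  qed
qed

section \<open>Closure properties of approximable functions\<close>

lemma sqdist_triangle:
  assumes "square_integrable M f" "square_integrable M g" "square_integrable M h"
  shows "sqdist f h \<le> 2 * sqdist f g + 2 * sqdist g h"
proof -
  have fg: "integrable M (\<lambda>x. (cmod (f x - g x))\<^sup>2)" and gh: "integrable M (\<lambda>x. (cmod (g x - h x))\<^sup>2)"
    and fh: "integrable M (\<lambda>x. (cmod (f x - h x))\<^sup>2)"
    using square_integrable_diff[OF assms(1,2)] square_integrable_diff[OF assms(2,3)]
      square_integrable_diff[OF assms(1,3)]
    by (auto simp: square_integrable_def)
  have "sqdist f h \<le> (\<integral>x. 2 * (cmod (f x - g x))\<^sup>2 + 2 * (cmod (g x - h x))\<^sup>2 \<partial>M)"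
    unfolding sqdist_def
  proof (rule integral_mono)
    fix x
    show "(cmod (f x - h x))\<^sup>2 \<le> 2 * (cmod (f x - g x))\<^sup>2 + 2 * (cmod (g x - h x))\<^sup>2"
      using cmod_add_squared_le[of "f x - g x" "g x - h x"] by simp
  qed (use fg gh fh in auto)
  also have "\<dots> = 2 * sqdist f g + 2 * sqdist g h"
    using fg gh by (simp add: sqdist_def)
  finally show ?thesis .
qed

lemma approximable_closed:
  assumes g: "square_integrable M g"
    and a: "\<And>\<epsilon>. \<epsilon> > 0 \<Longrightarrow> \<exists>h. approximable h \<and> sqdist g h < \<epsilon>"
  shows "approximable g"
  unfolding approximable_def
proof (intro conjI allI impI g)
  fix \<epsilon> :: real assume "\<epsilon> > 0"
  \<comment> \<open>Two distances below \<epsilon>/4, each doubled by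
    \<open>sqdist_triangle\<close>, add up to less than \<epsilon>.\<close>
  then obtain h where h: "approximable h" "sqdist g h < \<epsilon> / 4"
    using a[of "\<epsilon> / 4"] by auto
  then obtain F a where F: "finite F" "F \<subseteq> K" and lt: "sqdist h (\<lambda>x. \<Sum>k\<in>F. a k * e k x) < \<epsilon> / 4"
    using \<open>\<epsilon> > 0\<close> by (auto simp: approximable_def dest!: spec[of _ "\<epsilon> / 4"])
  have "square_integrable M h" using h by (simp add: approximable_def)
  from sqdist_triangle[OF g this square_integrable_span[OF F(2)], of a] h lt
  have "sqdist g (\<lambda>x. \<Sum>k\<in>F. a k * e k x) < \<epsilon>" by linarith
  with F show "\<exists>F a. finite F \<and> F \<subseteq> K \<and> sqdist g (\<lambda>x. \<Sum>k\<in>F. a k * e k x) < \<epsilon>" by blast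
qed

text \<open>Used to pass from continuous functions to indicators and from indicators to general
  functions: an envelope \<open>B\<close> with integrable square turns pointwise into mean-square
  convergence, since |g - s n|^2 is dominated by 4 B^2.\<close>

lemma approximable_limit:
  assumes s: "\<And>n::nat. approximable (s n)" and g: "g \<in> borel_measurable M"
    and lim: "\<And>x. x \<in> space M \<Longrightarrow> (\<lambda>n. s n x) \<longlonglongrightarrow> g x"
    and b: "\<And>n x. x \<in> space M \<Longrightarrow> cmod (s n x) \<le> B x" and B: "integrable M (\<lambda>x. (B x)\<^sup>2)"
  shows "approximable g"
proof (rule approximable_closed)
  note [measurable] = g
  have [measurable]: "s n \<in> borel_measurable M" for n
    using s[of n] by (auto simp: approximable_def square_integrable_def)
  have gB: "cmod (g x) \<le> B x" if "x \<in> space M" for x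
    by (rule tendsto_upperbound[OF tendsto_norm[OF lim[OF that]]]) (use b that in auto)
  show "square_integrable M g"
    unfolding square_integrable_def
  proof
    show "integrable M (\<lambda>x. (cmod (g x))\<^sup>2)"
      by (rule Bochner_Integration.integrable_bound[OF B]) (auto intro!: AE_I2 power_mono gB)
  qed fact
  have "(\<lambda>n. sqdist g (s n)) \<longlonglongrightarrow> (\<integral>x. 0 \<partial>M)"
    unfolding sqdist_def
  proof (rule integral_dominated_convergence[where w = "\<lambda>x. 4 * (B x)\<^sup>2"])
    show "AE x in M. (\<lambda>n. (cmod (g x - s n x))\<^sup>2) \<longlonglongrightarrow> 0"
    proof (rule AE_I2)
      fix x assume "x \<in> space M"
      from tendsto_power[OF tendsto_norm[OF tendsto_diff[OF tendsto_const lim[OF this]]], of "g x" 2]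
      show "(\<lambda>n. (cmod (g x - s n x))\<^sup>2) \<longlonglongrightarrow> 0" by simp
    qed
    show "AE x in M. norm ((cmod (g x - s n x))\<^sup>2) \<le> 4 * (B x)\<^sup>2" for n
    proof (rule AE_I2)
      fix x assume x: "x \<in> space M"
      have "cmod (g x - s n x) \<le> 2 * B x"
        using norm_triangle_ineq4[of "g x" "s n x"] gB[OF x] b[OF x, of n] by linarith
      from power_mono[OF this, of 2] show "norm ((cmod (g x - s n x))\<^sup>2) \<le> 4 * (B x)\<^sup>2"
        by (simp add: power_mult_distrib)
    qed
  qed (use B in auto)
  then have "(\<lambda>n. sqdist g (s n)) \<longlonglongrightarrow> 0" by simp
  then show "\<exists>h. approximable h \<and> sqdist g h < \<epsilon>" if "\<epsilon> > 0" for \<epsilon>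
    using order_tendstoD(2)[OF _ that] s by (metis (no_types, lifting) eventually_sequentially order_refl)
qed

lemma approximable_cmult:
  assumes "approximable g"
  shows "approximable (\<lambda>x. a * g x)"
  unfolding approximable_def
proof (intro conjI allI impI)
  have g: "square_integrable M g" using assms by (simp add: approximable_def)
  then show "square_integrable M (\<lambda>x. a * g x)"
    by (rule square_integrable_cmult)
  fix \<epsilon> :: real assume "\<epsilon> > 0"
  \<comment> \<open>The added 1 keeps the denominator positive when \<open>a = 0\<close>.\<close>
  have pos: "(cmod a)\<^sup>2 + 1 > 0" by (simp add: add_nonneg_pos)
  then obtain F b where F: "finite F" "F \<subseteq> K"
      and lt: "sqdist g (\<lambda>x. \<Sum>k\<in>F. b k * e k x) < \<epsilon> / ((cmod a)\<^sup>2 + 1)"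
    using assms \<open>\<epsilon> > 0\<close> by (auto simp: approximable_def dest!: spec[of _ "\<epsilon> / ((cmod a)\<^sup>2 + 1)"])
  have "sqdist (\<lambda>x. a * g x) (\<lambda>x. \<Sum>k\<in>F. (a * b k) * e k x)
      = (cmod a)\<^sup>2 * sqdist g (\<lambda>x. \<Sum>k\<in>F. b k * e k x)"
    unfolding sqdist_def mult.assoc
    by (simp add: norm_mult power_mult_distrib flip: sum_distrib_left right_diff_distrib)
  also have "\<dots> \<le> ((cmod a)\<^sup>2 + 1) * sqdist g (\<lambda>x. \<Sum>k\<in>F. b k * e k x)"
    by (intro mult_right_mono) (auto simp: sqdist_def)
  also have "\<dots> < \<epsilon>"
    using lt pos by (simp add: field_simps)
  finally show "\<exists>F c. finite F \<and> F \<subseteq> K \<and> sqdist (\<lambda>x. a * g x) (\<lambda>x. \<Sum>k\<in>F. c k * e k x) < \<epsilon>"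
    using F by (intro exI[of _ F] exI[of _ "\<lambda>k. a * b k"]) auto
qed

lemma approximable_add:
  assumes f: "approximable f" and g: "approximable g"
  shows "approximable (\<lambda>x. f x + g x)"
  unfolding approximable_def
proof (intro conjI allI impI)
  have sf: "square_integrable M f" and sg: "square_integrable M g"
    using f g by (auto simp: approximable_def)
  then show sfg: "square_integrable M (\<lambda>x. f x + g x)"
    by (rule square_integrable_add)
  fix \<epsilon> :: real assume "\<epsilon> > 0"
  obtain F a where F: "finite F" "F \<subseteq> K" and lf: "sqdist f (\<lambda>x. \<Sum>k\<in>F. a k * e k x) < \<epsilon> / 4"
    using f \<open>\<epsilon> > 0\<close> by (auto simp: approximable_def dest!: spec[of _ "\<epsilon> / 4"])
  obtain G b where G: "finite G" "G \<subseteq> K" and lg: "sqdist g (\<lambda>x. \<Sum>k\<in>G. b k * e k x) < \<epsilon> / 4"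
    using g \<open>\<epsilon> > 0\<close> by (auto simp: approximable_def dest!: spec[of _ "\<epsilon> / 4"])
  define p where "p x = (\<Sum>k\<in>F. a k * e k x)" for x
  define q where "q x = (\<Sum>k\<in>G. b k * e k x)" for x
  \<comment> \<open>Both coefficient families are extended by zero, so that one family on the union
    of \<open>F\<close> and \<open>G\<close> represents \<open>p + q\<close>.\<close>
  define c where "c k = (if k \<in> F then a k else 0) + (if k \<in> G then b k else 0)" for k
  have p: "square_integrable M p" and q: "square_integrable M q"
    unfolding p_def[abs_def] q_def[abs_def] by (intro square_integrable_span F G)+
  have c: "(\<Sum>k\<in>F \<union> G. c k * e k x) = p x + q x" for x
  proof -
    have "(\<Sum>k\<in>F \<union> G. c k * e k x) = (\<Sum>k\<in>F \<union> G. if k \<in> F then a k * e k x else 0)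
        + (\<Sum>k\<in>F \<union> G. if k \<in> G then b k * e k x else 0)"
      unfolding c_def sum.distrib[symmetric] by (intro sum.cong) (auto simp: distrib_right)
    also have "\<dots> = p x + q x"
      using F G by (simp add: p_def q_def sum.If_cases Int_absorb1)
    finally show ?thesis .
  qed
  have "sqdist (\<lambda>x. f x + g x) (\<lambda>x. p x + q x)
      \<le> 2 * sqdist (\<lambda>x. f x + g x) (\<lambda>x. p x + g x) + 2 * sqdist (\<lambda>x. p x + g x) (\<lambda>x. p x + q x)"
    by (intro sqdist_triangle square_integrable_add sf sg p q)
  also have "\<dots> = 2 * sqdist f p + 2 * sqdist g q"
    by (simp add: sqdist_def)
  also have "\<dots> < \<epsilon>"
    using lf lg by (simp add: p_def[abs_def] q_def[abs_def])
  finally show "\<exists>F c. finite F \<and> F \<subseteq> K \<and> sqdist (\<lambda>x. f x + g x) (\<lambda>x. \<Sum>k\<in>F. c k * e k x) < \<epsilon>"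
    using F G by (intro exI[of _ "F \<union> G"] exI[of _ c]) (simp add: c)
qed

lemma approximable_e: "k \<in> K \<Longrightarrow> approximable (e k)"
  by (auto simp: approximable_def sqdist_def square_integrable_e intro!: exI[of _ "{k}"] exI[of _ "\<lambda>_. 1"])

lemma approximable_0: "approximable (\<lambda>x. 0)"
  by (auto simp: approximable_def sqdist_def square_integrable_def intro!: exI[of _ "{}"])

lemma approximable_sum:
  "(\<And>i. i \<in> I \<Longrightarrow> approximable (h i)) \<Longrightarrow> approximable (\<lambda>x. \<Sum>i\<in>I. h i x)"
  by (induction I rule: infinite_finite_induct) (auto intro: approximable_add approximable_0)

lemma approximable_cong:
  assumes "\<And>x. x \<in> space M \<Longrightarrow> f x = g x"
  shows "approximable f \<longleftrightarrow> approximable g"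
proof -
  have "square_integrable M f \<longleftrightarrow> square_integrable M g"
    unfolding square_integrable_def using assms
    by (intro conj_cong measurable_cong Bochner_Integration.integrable_cong) auto
  moreover have "sqdist f h = sqdist g h" for h
    unfolding sqdist_def using assms by (intro Bochner_Integration.integral_cong) auto
  ultimately show ?thesis
    by (simp add: approximable_def)
qed

section \<open>From indicators of a generator to all square-integrable functions\<close>

lemma approximable_if_indicators:
  assumes ind: "\<And>A. A \<in> sets M \<Longrightarrow> approximable (indicator A)" and g: "square_integrable M g"
  shows "approximable g"
proof -
  have "g \<in> borel_measurable M" using g by (simp add: square_integrable_def)
  \<comment> \<open>Simple functions centred at 0 satisfy |s n| \<le> 2 |g|, so 2 |g| is an envelope
    with integrable square.\<close>
  from borel_measurable_implies_sequence_metric[OF this, of 0] obtain s where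
    s: "\<And>n. simple_function M (s n)" and lim: "\<And>x. x \<in> space M \<Longrightarrow> (\<lambda>n. s n x) \<longlonglongrightarrow> g x"
    and b: "\<And>n x. x \<in> space M \<Longrightarrow> cmod (s n x) \<le> 2 * cmod (g x)"
    by simp metis
  show ?thesis
  proof (rule approximable_limit[OF _ _ lim b])
    fix n
    have "approximable (\<lambda>x. \<Sum>y\<in>s n ` space M. y * indicator (s n -` {y} \<inter> space M) x)"
      using s[of n] by (intro approximable_sum approximable_cmult ind) (auto simp: simple_function_def)
    moreover have "(\<Sum>y\<in>s n ` space M. y * indicator (s n -` {y} \<inter> space M) x) = s n x"
      if "x \<in> space M" for x
    proof -
      have "(\<Sum>y\<in>s n ` space M. y * indicator (s n -` {y} \<inter> space M) x)
          = (\<Sum>y\<in>s n ` space M. if y = s n x then y else 0)"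
        using that by (intro sum.cong) (auto simp: indicator_def)
      then show ?thesis
        using that s[of n] by (simp add: simple_function_def sum.delta)
    qed
    ultimately show "approximable (s n)"
      using approximable_cong[of "s n"] by (metis (no_types, lifting))
  qed (use g in \<open>auto simp: square_integrable_def power_mult_distrib\<close>)
qed

text \<open>A Dynkin argument: complements and disjoint unions become differences and bounded limits
  of sums, while intersections would demand products of approximable functions. Hence the
  intersection-stable generator.\<close>

lemma approximable_if_generator:
  assumes stable: "Int_stable G" and G: "G \<subseteq> Pow (space M)" and sets: "sets M = sigma_sets (space M) G"
    and ind: "\<And>A. A \<in> G \<Longrightarrow> approximable (indicator A)"
    and one: "approximable (\<lambda>_. 1)" and g: "square_integrable M g"
  shows "approximable g"
proof (rule approximable_if_indicators[OF _ g])
  fix A assume "A \<in> sets M"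
  then have "A \<in> sigma_sets (space M) G" by (simp add: sets)
  then show "approximable (indicator A)"
  proof (induction rule: sigma_sets_induct_disjoint[OF stable G, consumes 1, case_names basic empty compl union])
    case (basic A)
    then show ?case by (rule ind)
  next
    case empty
    then show ?case using approximable_0 by simp
  next
    case (compl A)
    have "approximable (\<lambda>x. 1 + -1 * indicator A x)"
      by (intro approximable_add approximable_cmult one compl)
    then show ?case
      by (rule approximable_cong[THEN iffD1, rotated]) (auto simp: indicator_def)
  next
    case (union A)
    have A: "A i \<in> sets M" for i using union(2) by (auto simp: sets)
    show ?case
    proof (rule approximable_limit[where B = "\<lambda>_. 1"])
      show "approximable (\<lambda>x. \<Sum>i<n. indicator (A i) x)" for n
        by (intro approximable_sum union)
      \<comment> \<open>Disjointness makes each partial sum an indicator again, so the constant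
        envelope 1 works for every \<open>n\<close>.\<close>
      have eq: "(\<Sum>i<n. indicator (A i) x) = (indicator (\<Union>i<n. A i) x :: complex)" for n x
        using union(1) by (subst indicator_UN_disjoint) (auto simp: disjoint_family_on_def)
      show "(\<lambda>n. \<Sum>i<n. indicator (A i) x) \<longlonglongrightarrow> (indicator (\<Union> (range A)) x :: complex)" for x
        unfolding eq by (rule LIMSEQ_indicator_UN)
      show "cmod (\<Sum>i<n. indicator (A i) x) \<le> 1" for n x
        unfolding eq by (auto simp: indicator_def)
      show "indicator (\<Union> (range A)) \<in> borel_measurable M"
        using A by (intro borel_measurable_indicator) auto
    qed auto
  qed
qed

end

subsection \<open>Fourier analysis on the torus\<close>

abbreviation unit_lborel :: "real measure" where
  "unit_lborel \<equiv> restrict_space lborel {0..<1}"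

interpretation unit_lborel: prob_space unit_lborel
  by (rule prob_spaceI) (simp add: emeasure_restrict_space space_restrict_space)

interpretation torus: product_sigma_finite "\<lambda>_::nat. unit_lborel"
  by unfold_locales

lemma prob_space_TorOn: "prob_space (TorOn I)"
  unfolding TorOn_def by (intro prob_space_PiM unit_lborel.prob_space_axioms)

lemma space_TorOn: "space (TorOn I) = (\<Pi>\<^sub>E i\<in>I. {0..<1})"
  by (simp add: TorOn_def space_PiM space_restrict_space)

lemma measurable_TorOn_component: "j \<in> I \<Longrightarrow> (\<lambda>x. x j) \<in> borel_measurable (TorOn I)"
proof -
  assume "j \<in> I"
  then have "(\<lambda>x. x j) \<in> measurable (TorOn I) unit_lborel"
    unfolding TorOn_def by (rule measurable_component_singleton)
  moreover have "(\<lambda>x. x) \<in> borel_measurable unit_lborel"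
    by (intro measurable_restrict_space1) simp
  ultimately show ?thesis
    using measurable_compose by blast
qed

lemma integral_cis_unit_lborel:
  "(\<integral>t. cis (2 * pi * of_int n * t) \<partial>unit_lborel) = (if n = 0 then 1 else 0)"
proof (cases "n = 0")
  case True
  then show ?thesis
    using unit_lborel.prob_space by simp
next
  case False
  define c where "c = 2 * pi * of_int n"
  have c: "c \<noteq> 0" using False by (simp add: c_def)
  have cis_borel: "(\<lambda>t. cis (c * t)) \<in> borel_measurable borel"
    by (intro borel_measurable_continuous_onI continuous_intros)
  have "(\<integral>t. cis (c * t) \<partial>unit_lborel) = (\<integral>t. indicator {0..<1} t *\<^sub>R cis (c * t) \<partial>lborel)"
    by (subst integral_restrict_space) (auto simp: set_lebesgue_integral_def)
  \<comment> \<open>Adding the null point 1 allows the fundamental theorem of calculus on a closed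
    interval.\<close>
  also have "\<dots> = (\<integral>t. indicator {0..1} t *\<^sub>R cis (c * t) \<partial>lborel)"
  proof (rule integral_cong_AE)
    have "AE t in lborel. t \<noteq> (1::real)" by (rule AE_lborel_singleton)
    then show "AE t in lborel. indicator {0..<1} t *\<^sub>R cis (c * t) = indicator {0..1} t *\<^sub>R cis (c * t)"
      by eventually_elim (auto simp: indicator_def)
  qed (use cis_borel in measurable)
  also have "\<dots> = cis (c * 1) / (\<i> * c) - cis (c * 0) / (\<i> * c)"
  proof (rule integral_FTC_Icc)
    show "((\<lambda>t. cis (c * t) / (\<i> * c)) has_vector_derivative cis (c * t)) (at t within {0..1})" for t
    proof -
      have "((\<lambda>z. exp (\<i> * c * z) / (\<i> * c)) has_field_derivative exp (\<i> * c * of_real t))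
          (at (of_real t))"
        using c by (auto intro!: derivative_eq_intros)
      from has_vector_derivative_real_field[OF this]
      show ?thesis
        by (simp add: cis_conv_exp mult.assoc)
    qed
  qed (auto intro!: continuous_intros)
  also have "cis (c * 1) = 1"
    using cis_multiple_2pi[of "of_int n"] by (simp add: c_def)
  finally show ?thesis
    using False by (simp add: c_def)
qed

text \<open>\<open>Zd\<close> over an arbitrary index set. Vanishing outside \<open>I\<close> makes
  frequencies that agree on \<open>I\<close> equal, as orthonormality of distinct indices
  requires.\<close>

definition Freq :: "nat set \<Rightarrow> (nat \<Rightarrow> int) set" where
  "Freq I = {k. \<forall>j. j \<notin> I \<longrightarrow> k j = 0}"

text \<open>The exponential is written as a product over coordinates so that Fubini factors its
  integral and \<open>merge\<close> splits it into a part on \<open>u\<close> and a part on the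
  complement.\<close>

definition character :: "nat set \<Rightarrow> (nat \<Rightarrow> int) \<Rightarrow> (nat \<Rightarrow> real) \<Rightarrow> complex" where
  "character I k x = (\<Prod>j\<in>I. cis (2 * pi * of_int (k j) * x j))"

lemma cmod_character: "cmod (character I k x) = 1"
  by (simp add: character_def prod_norm[symmetric])

lemma character_add: "character I (\<lambda>j. k j + l j) x = character I k x * character I l x"
  by (simp add: character_def cis_mult algebra_simps flip: prod.distrib)

lemma cnj_character: "cnj (character I k x) = character I (\<lambda>j. - k j) x"
  by (simp add: character_def cis_cnj)

lemma character_measurable [measurable]: "character I k \<in> borel_measurable (TorOn I)"
  unfolding character_def[abs_def]
proof (rule borel_measurable_prod)
  fix j assume "j \<in> I"
  from measurable_TorOn_component[OF this]
  have "(\<lambda>x. 2 * pi * of_int (k j) * x j) \<in> borel_measurable (TorOn I)" by measurable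
  then show "(\<lambda>x. cis (2 * pi * of_int (k j) * x j)) \<in> borel_measurable (TorOn I)"
    by (rule measurable_compose) (intro borel_measurable_continuous_onI continuous_intros)
qed

lemma integral_character:
  assumes "finite I"
  shows "(\<integral>x. character I k x \<partial>TorOn I) = (if \<forall>j\<in>I. k j = 0 then 1 else 0)"
proof -
  have "integrable unit_lborel (\<lambda>t. cis (2 * pi * of_int n * t))" for n
    by (rule unit_lborel.integrable_const_bound[where B = 1])
       (auto intro!: measurable_restrict_space1 borel_measurable_continuous_onI continuous_intros)
  then have "(\<integral>x. character I k x \<partial>TorOn I) = (\<Prod>j\<in>I. \<integral>t. cis (2 * pi * of_int (k j) * t) \<partial>unit_lborel)"
    unfolding character_def TorOn_def using assms
    by (intro torus.product_integral_prod[where f = "\<lambda>j t. cis (2 * pi * of_int (k j) * t)"])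
  also have "\<dots> = (if \<forall>j\<in>I. k j = 0 then 1 else 0)"
    unfolding integral_cis_unit_lborel using assms by (auto intro!: prod.neutral)
  finally show ?thesis .
qed

lemma bounded_orthonormal_character:
  assumes "finite I"
  shows "bounded_orthonormal (TorOn I) (character I) (Freq I)"
proof (intro bounded_orthonormal.intro bounded_orthonormal_axioms.intro prob_space_TorOn)
  fix k l assume "k \<in> Freq I" "l \<in> Freq I"
  then have "(\<forall>j\<in>I. k j - l j = 0) \<longleftrightarrow> k = l"
    by (auto simp: Freq_def fun_eq_iff)
  then show "(\<integral>x. character I k x * cnj (character I l x) \<partial>TorOn I) = (if k = l then 1 else 0)"
    using integral_character[OF assms, of "\<lambda>j. k j - l j"] character_add[of I k "\<lambda>j. - l j"]
    by (simp add: cnj_character)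
qed (auto simp: cmod_character)

section \<open>Trigonometric polynomials and uniform approximation\<close>

inductive_set trig_poly :: "nat set \<Rightarrow> ((nat \<Rightarrow> real) \<Rightarrow> complex) set" for I where
  character: "k \<in> Freq I \<Longrightarrow> character I k \<in> trig_poly I"
| cmult: "p \<in> trig_poly I \<Longrightarrow> (\<lambda>x. a * p x) \<in> trig_poly I"
| add: "p \<in> trig_poly I \<Longrightarrow> q \<in> trig_poly I \<Longrightarrow> (\<lambda>x. p x + q x) \<in> trig_poly I"

text \<open>The inductive presentation of the span reduces products to products of characters by a
  nested induction; sums over frequencies never have to be multiplied out.\<close>

lemma trig_poly_mult:
  assumes "p \<in> trig_poly I" "q \<in> trig_poly I"
  shows "(\<lambda>x. p x * q x) \<in> trig_poly I"
  using assms
proof (induction p rule: trig_poly.induct)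
  case (character k)
  from this(2,1) show ?case
  proof (induction q rule: trig_poly.induct)
    case (character l)
    have "character I (\<lambda>j. k j + l j) \<in> trig_poly I"
      using character by (intro trig_poly.character) (auto simp: Freq_def)
    then show ?case by (simp add: character_add[abs_def])
  next
    case (cmult q a)
    then show ?case using trig_poly.cmult[of "\<lambda>x. character I k x * q x" I a] by (simp add: mult.left_commute)
  next
    case (add q r)
    then show ?case
      using trig_poly.add[of "\<lambda>x. character I k x * q x" I "\<lambda>x. character I k x * r x"]
      by (simp add: distrib_left)
  qed
next
  case (cmult p a)
  then show ?case using trig_poly.cmult[of "\<lambda>x. p x * q x" I a] by (simp add: mult.assoc)
next
  case (add p r)
  then show ?case
    using trig_poly.add[of "\<lambda>x. p x * q x" I "\<lambda>x. r x * q x"] by (simp add: distrib_right)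
qed

lemma trig_poly_const: "(\<lambda>x. c) \<in> trig_poly I"
  using trig_poly.cmult[OF trig_poly.character[of "\<lambda>_. 0" I], of c]
  by (simp add: Freq_def character_def)

lemma trig_poly_bounded: "p \<in> trig_poly I \<Longrightarrow> \<exists>B\<ge>0. \<forall>x. cmod (p x) \<le> B"
proof (induction p rule: trig_poly.induct)
  case (character k)
  then show ?case by (intro exI[of _ 1]) (simp add: cmod_character)
next
  case (cmult p a)
  then obtain B where "B \<ge> 0" "\<And>x. cmod (p x) \<le> B" by blast
  then show ?case
    by (intro exI[of _ "cmod a * B"]) (auto simp: norm_mult intro!: mult_left_mono)
next
  case (add p q)
  then obtain B C where "B \<ge> 0" "\<And>x. cmod (p x) \<le> B" "C \<ge> 0" "\<And>x. cmod (q x) \<le> C" by blast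
  then show ?case
    by (intro exI[of _ "B + C"]) (auto intro!: norm_triangle_mono)
qed

lemma trig_poly_cis: "j \<in> I \<Longrightarrow> finite I \<Longrightarrow> (\<lambda>x. cis (2 * pi * of_int n * x j)) \<in> trig_poly I"
proof -
  assume j: "j \<in> I" "finite I"
  have "character I (\<lambda>i. if i = j then n else 0) \<in> trig_poly I"
    using j by (intro trig_poly.character) (auto simp: Freq_def)
  moreover have "character I (\<lambda>i. if i = j then n else 0) x = cis (2 * pi * of_int n * x j)" for x
  proof -
    have "character I (\<lambda>i. if i = j then n else 0) x
        = (\<Prod>i\<in>I. if i = j then cis (2 * pi * of_int n * x j) else 1)"
      unfolding character_def by (intro prod.cong) auto
    then show ?thesis using j by simp
  qed
  ultimately show ?thesis
    by (metis (no_types, lifting) ext)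
qed

text \<open>Real polynomials in a complex number are polynomials in its real and imaginary parts; on
  the circle these are cosine and sine, hence combinations of \<open>cis t\<close> and
  \<open>cis (- t)\<close>.\<close>

lemma trig_poly_real_polynomial:
  assumes p: "real_polynomial_function p" and j: "j \<in> I" "finite I"
  shows "(\<lambda>x. complex_of_real (p (cis (2 * pi * x j)))) \<in> trig_poly I"
  using p
proof (induction p rule: real_polynomial_function.induct)
  case (linear f)
  then interpret bounded_linear f .
  \<comment> \<open>Euler's formulas applied to f(cis t) = f(1) cos t + f(\<i>) sin t give the
    coefficients of \<open>cis t\<close> and \<open>cis (- t)\<close>.\<close>
  define a where "a = (of_real (f 1) - \<i> * of_real (f \<i>)) / 2"
  define b where "b = (of_real (f 1) + \<i> * of_real (f \<i>)) / 2"
  have f: "of_real (f (cis t)) = a * cis t + b * cis (- t)" for t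
  proof -
    have "f (cis t) = f (cos t *\<^sub>R 1 + sin t *\<^sub>R \<i>)"
      by (rule arg_cong[of _ _ f]) (auto simp: complex_eq_iff)
    then show ?thesis
      by (simp add: add scale a_def b_def complex_eq_iff algebra_simps add_divide_distrib diff_divide_distrib)
  qed
  have "(\<lambda>x. a * cis (2 * pi * of_int 1 * x j) + b * cis (2 * pi * of_int (-1) * x j)) \<in> trig_poly I"
    by (intro trig_poly.add trig_poly.cmult trig_poly_cis j)
  then show ?case by (simp add: f)
next
  case (const c)
  then show ?case by (simp add: trig_poly_const)
next
  case (add p q)
  then show ?case using trig_poly.add by fastforce
next
  case (mult p q)
  then show ?case using trig_poly_mult by fastforce
qed

text \<open>Uniform approximation precedes mean-square approximation because it survives products.
  Quantifying over all \<open>x\<close>, not only over the torus, is harmless: the functions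
  concerned depend on \<open>x\<close> only through the values
  \<open>cis (2 * pi * x j)\<close>.\<close>

definition unif_approximable :: "nat set \<Rightarrow> ((nat \<Rightarrow> real) \<Rightarrow> complex) \<Rightarrow> bool" where
  "unif_approximable I h \<longleftrightarrow> (\<forall>\<epsilon>>0. \<exists>p\<in>trig_poly I. \<forall>x. cmod (h x - p x) \<le> \<epsilon>)"

lemma unif_approximableD:
  assumes "unif_approximable I h" "\<epsilon> > 0"
  obtains p where "p \<in> trig_poly I" "\<And>x. cmod (h x - p x) \<le> \<epsilon>"
  using assms by (auto simp: unif_approximable_def)

lemma unif_approximable_bounded:
  assumes "unif_approximable I h"
  shows "\<exists>B\<ge>0. \<forall>x. cmod (h x) \<le> B"
proof -
  obtain p where p: "p \<in> trig_poly I" "\<And>x. cmod (h x - p x) \<le> 1"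
    using assms zero_less_one unfolding unif_approximable_def by blast
  obtain B where B: "B \<ge> 0" "\<And>x. cmod (p x) \<le> B"
    using trig_poly_bounded[OF p(1)] by blast
  show ?thesis
  proof (intro exI[of _ "B + 1"] conjI allI)
    show "cmod (h x) \<le> B + 1" for x
      using norm_triangle_ineq[of "p x" "h x - p x"] B(2)[of x] p(2)[of x] by simp
  qed (use B in simp)
qed

lemma unif_approximable_trig_poly: "p \<in> trig_poly I \<Longrightarrow> unif_approximable I p"
  unfolding unif_approximable_def by (auto intro!: bexI[of _ p])

lemma unif_approximable_mult:
  assumes g: "unif_approximable I g" and h: "unif_approximable I h"
  shows "unif_approximable I (\<lambda>x. g x * h x)"
  unfolding unif_approximable_def
proof (intro allI impI)
  fix \<epsilon> :: real assume \<epsilon>: "\<epsilon> > 0"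
  obtain B where B: "B \<ge> 0" "\<And>x. cmod (g x) \<le> B"
    using unif_approximable_bounded[OF g] by blast
  \<comment> \<open>The estimate rests on g h - p q = g (h - q) + (g - p) q. Hence \<open>q\<close>
    comes first, with an error scaled by the bound on \<open>g\<close>, and \<open>p\<close> second,
    with an error scaled by the bound on \<open>q\<close>; adding 1 keeps the denominators
    positive.\<close>
  obtain q where q: "q \<in> trig_poly I" "\<And>x. cmod (h x - q x) \<le> \<epsilon> / (2 * (B + 1))"
    using unif_approximableD[OF h, of "\<epsilon> / (2 * (B + 1))"] \<epsilon> B by auto
  obtain C where C: "C \<ge> 0" "\<And>x. cmod (q x) \<le> C"
    using trig_poly_bounded[OF q(1)] by blast
  obtain p where p: "p \<in> trig_poly I" "\<And>x. cmod (g x - p x) \<le> \<epsilon> / (2 * (C + 1))"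
    using unif_approximableD[OF g, of "\<epsilon> / (2 * (C + 1))"] \<epsilon> C by auto
  show "\<exists>p\<in>trig_poly I. \<forall>x. cmod (g x * h x - p x) \<le> \<epsilon>"
  proof (intro bexI[of _ "\<lambda>x. p x * q x"] allI trig_poly_mult p(1) q(1))
    fix x
    have "cmod (g x * h x - p x * q x) = cmod (g x * (h x - q x) + (g x - p x) * q x)"
      by (simp add: algebra_simps)
    also have "\<dots> \<le> cmod (g x) * cmod (h x - q x) + cmod (g x - p x) * cmod (q x)"
      by (rule order.trans[OF norm_triangle_ineq]) (simp add: norm_mult)
    also have "\<dots> \<le> (B + 1) * (\<epsilon> / (2 * (B + 1))) + \<epsilon> / (2 * (C + 1)) * (C + 1)"
      using B(1) B(2)[of x] C(1) C(2)[of x] p(2)[of x] q(2)[of x] \<epsilon>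
      by (intro add_mono mult_mono) auto
    also have "\<dots> = \<epsilon>"
    proof -
      have half: "D * (\<epsilon> / (2 * D)) = \<epsilon> / 2" if "D \<noteq> 0" for D :: real
        using that by simp
      have "(B + 1) * (\<epsilon> / (2 * (B + 1))) = \<epsilon> / 2"
        by (rule half) (use B(1) in simp)
      moreover have "(C + 1) * (\<epsilon> / (2 * (C + 1))) = \<epsilon> / 2"
        by (rule half) (use C(1) in simp)
      ultimately show ?thesis
        by (simp only: mult.commute[of _ "C + 1"] field_sum_of_halves)
    qed
    finally show "cmod (g x * h x - p x * q x) \<le> \<epsilon>" .
  qed
qed

lemma unif_approximable_prod:
  "(\<And>j. j \<in> J \<Longrightarrow> unif_approximable I (h j)) \<Longrightarrow> unif_approximable I (\<lambda>x. \<Prod>j\<in>J. h j x)"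
  by (induction J rule: infinite_finite_induct)
     (auto intro: unif_approximable_mult unif_approximable_trig_poly trig_poly_const)

text \<open>Compactness of the circle allows Stone-Weierstrass, and taking \<phi> on the circle
  builds in the periodicity that uniform limits of trigonometric polynomials must have.\<close>

lemma unif_approximable_circle:
  fixes \<phi> :: "complex \<Rightarrow> real"
  assumes \<phi>: "continuous_on (sphere 0 1) \<phi>" and j: "j \<in> I" "finite I"
  shows "unif_approximable I (\<lambda>x. of_real (\<phi> (cis (2 * pi * x j))))"
  unfolding unif_approximable_def
proof (intro allI impI)
  fix \<epsilon> :: real assume "\<epsilon> > 0"
  then obtain p where p: "real_polynomial_function p" "\<And>z. z \<in> sphere 0 1 \<Longrightarrow> \<bar>\<phi> z - p z\<bar> < \<epsilon>"
    using Stone_Weierstrass_real_polynomial_function[OF compact_sphere \<phi>] by blast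
  show "\<exists>q\<in>trig_poly I. \<forall>x. cmod (of_real (\<phi> (cis (2 * pi * x j))) - q x) \<le> \<epsilon>"
  proof (intro bexI[OF _ trig_poly_real_polynomial[OF p(1) j]] allI)
    fix x :: "nat \<Rightarrow> real"
    show "cmod (of_real (\<phi> (cis (2 * pi * x j))) - of_real (p (cis (2 * pi * x j)))) \<le> \<epsilon>"
      using p(2)[of "cis (2 * pi * x j)"] by (simp flip: of_real_diff)
  qed
qed

text \<open>Each \<open>C j\<close> will be closed in the plane, so that distance cutoffs
  approximate its indicator by continuous functions on the circle; it need not be an arc.\<close>

definition arc_box :: "nat set \<Rightarrow> (nat \<Rightarrow> complex set) \<Rightarrow> (nat \<Rightarrow> real) set" where
  "arc_box I C = {x \<in> space (TorOn I). \<forall>j\<in>I. cis (2 * pi * x j) \<in> C j}"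

text \<open>Wrapping [0,1) onto the circle is injective but not a homeomorphism. Still, each [0,a]
  with a < 1 is the preimage of its own image, a compact arc, and these intervals generate the Borel
  sets.\<close>

lemma sets_unit_lborel:
  "sets unit_lborel = sets (sigma {0..<1} {{t \<in> {0..<1}. cis (2 * pi * t) \<in> C} | C. closed C})"
    (is "_ = sets (sigma _ ?E)")
proof
  let ?S = "sigma {0..<1} ?E"
  have E: "?E \<subseteq> Pow {0..<1}" by auto
  have sp: "space ?S = {0..<1}" using E by (simp add: space_measure_of_conv)
  have id: "(\<lambda>t. t) \<in> borel_measurable ?S"
    unfolding borel_measurable_iff_le
  proof
    fix a :: real
    consider "a < 0" | "0 \<le> a" "a < 1" | "1 \<le> a" by linarith
    then show "{t \<in> space ?S. t \<le> a} \<in> sets ?S"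
    proof cases
      case 1
      then have "{t \<in> space ?S. t \<le> a} = {}" unfolding sp by auto
      then show ?thesis by (simp only: sets.empty_sets)
    next
      case 3
      then have "{t \<in> space ?S. t \<le> a} = space ?S" unfolding sp by auto
      then show ?thesis by (simp only: sets.top)
    next
      case 2
      let ?C = "(\<lambda>t. cis (2 * pi * t)) ` {0..a}"
      have "compact ?C"
        by (intro compact_continuous_image continuous_intros) auto
      then have "closed ?C" by (rule compact_imp_closed)
      moreover have "{t \<in> space ?S. t \<le> a} = {t \<in> {0..<1}. cis (2 * pi * t) \<in> ?C}"
      proof -
        have "t \<le> a" if t: "0 \<le> t" "t < 1" and s: "0 \<le> s" "s \<le> a" "cis (2 * pi * t) = cis (2 * pi * s)" for t s
        proof -
          have "sin (2 * pi * t) = sin (2 * pi * s) \<and> cos (2 * pi * t) = cos (2 * pi * s)"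
            using s(3) by (simp add: complex_eq_iff)
          then obtain n :: int where "2 * pi * t = 2 * pi * s + 2 * pi * n"
            unfolding sin_cos_eq_iff by blast
          then have "2 * pi * t = 2 * pi * (s + n)" by (simp add: distrib_left)
          \<comment> \<open>Points with the same image differ by an integer \<open>n\<close>;
            \<open>t < 1\<close> and \<open>0 \<le> s\<close> force \<open>n \<le> 0\<close>, hence
            \<open>t \<le> s \<le> a\<close>.\<close>
          then have "t = s + n" by simp
          then have "real_of_int n < 1" using t s by linarith
          then have "real_of_int n \<le> 0" by simp
          with \<open>t = s + n\<close> s show ?thesis by linarith
        qed
        then show ?thesis unfolding sp by auto
      qed
      ultimately have "{t \<in> space ?S. t \<le> a} \<in> ?E" by blast
      then show ?thesis using E by (simp add: sets_measure_of)
    qed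
  qed
  show "sets unit_lborel \<subseteq> sets ?S"
  proof (intro subsetI)
    fix A assume "A \<in> sets unit_lborel"
    then obtain B where B: "B \<in> sets borel" "A = {0..<1} \<inter> B"
      by (auto simp: sets_restrict_space)
    from measurable_sets[OF id B(1)] show "A \<in> sets ?S"
      unfolding sp B(2) by (simp only: vimage_ident Int_commute)
  qed
  show "sets ?S \<subseteq> sets unit_lborel"
  proof (unfold sets_measure_of[OF E], rule sets.sigma_sets_subset[of _ unit_lborel, unfolded space_restrict_space, simplified])
    show "?E \<subseteq> sets unit_lborel"
    proof
      fix A assume "A \<in> ?E"
      then obtain C where C: "closed C" "A = {t \<in> {0..<1}. cis (2 * pi * t) \<in> C}" by blast
      have A: "A = {0..<1} \<inter> ((\<lambda>t. cis (2 * pi * t)) -` C)" unfolding C(2) by auto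
      have "closed ((\<lambda>t. cis (2 * pi * t)) -` C)"
        using C(1) by (intro continuous_closed_vimage continuous_intros) auto
      then show "A \<in> sets unit_lborel"
        unfolding A sets_restrict_space by auto
    qed
  qed
qed

lemma sets_TorOn:
  assumes "finite I"
  shows "sets (TorOn I) = sigma_sets (space (TorOn I)) {arc_box I C | C. \<forall>j\<in>I. closed (C j)}"
proof -
  let ?E = "{{t \<in> {0..<1}. cis (2 * pi * t) \<in> C} | C. closed C}"
  \<comment> \<open>Restricting the family of index sets to \<open>{I}\<close> makes every generator
    constrain all coordinates; a free coordinate is the case \<open>C j = UNIV\<close>.\<close>
  let ?P = "{{f \<in> \<Pi>\<^sub>E i\<in>I. {0..<1::real}. \<forall>i\<in>j. f i \<in> A i} | A j. j \<in> {I} \<and> A \<in> Pi j (\<lambda>_. ?E)}"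
  have "sets (TorOn I) = sets (PiM I (\<lambda>_. sigma {0..<1} ?E))"
    unfolding TorOn_def by (intro sets_PiM_cong refl sets_unit_lborel)
  also have "\<dots> = sets (sigma (\<Pi>\<^sub>E i\<in>I. {0..<1}) ?P)"
  proof (rule sets_PiM_sigma)
    have "{0..<1} \<in> ?E"
      using closed_UNIV by (intro CollectI exI[of _ UNIV]) auto
    then show "\<exists>S\<subseteq>?E. countable S \<and> {0..<1} = \<Union> S"
      by (intro exI[of _ "{{0..<1}}"]) auto
  qed (use assms in auto)
  also have "\<dots> = sigma_sets (\<Pi>\<^sub>E i\<in>I. {0..<1}) ?P"
    by (intro sets_measure_of) auto
  also have "?P = {arc_box I C | C. \<forall>j\<in>I. closed (C j)}"
  proof (intro subset_antisym subsetI)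
    fix B assume "B \<in> ?P"
    then obtain A where A: "A \<in> Pi I (\<lambda>_. ?E)"
        and B: "B = {f \<in> \<Pi>\<^sub>E i\<in>I. {0..<1}. \<forall>i\<in>I. f i \<in> A i}" by auto
    have "\<forall>i\<in>I. \<exists>C. closed C \<and> A i = {t \<in> {0..<1}. cis (2 * pi * t) \<in> C}"
      using A by (auto simp: Pi_iff)
    then obtain C where C: "\<And>i. i \<in> I \<Longrightarrow> closed (C i) \<and> A i = {t \<in> {0..<1}. cis (2 * pi * t) \<in> C i}"
      by metis
    have "B = arc_box I C"
      unfolding B arc_box_def space_TorOn using C by auto
    then show "B \<in> {arc_box I C | C. \<forall>j\<in>I. closed (C j)}" using C by blast
  next
    fix B assume "B \<in> {arc_box I C | C. \<forall>j\<in>I. closed (C j)}"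
    then obtain C where C: "\<forall>j\<in>I. closed (C j)" and B: "B = arc_box I C" by blast
    define A where "A j = {t \<in> {0..<1::real}. cis (2 * pi * t) \<in> C j}" for j
    have "A \<in> Pi I (\<lambda>_. ?E)"
      using C by (auto simp: A_def)
    moreover have "B = {f \<in> \<Pi>\<^sub>E i\<in>I. {0..<1}. \<forall>i\<in>I. f i \<in> A i}"
      unfolding B arc_box_def space_TorOn by (auto simp: A_def)
    ultimately show "B \<in> ?P" by blast
  qed
  finally show ?thesis by (simp add: space_TorOn)
qed

lemma Int_stable_boxes: "Int_stable {arc_box I C | C. \<forall>j\<in>I. closed (C j)}"
proof (rule Int_stableI)
  fix A B assume "A \<in> {arc_box I C | C. \<forall>j\<in>I. closed (C j)}" "B \<in> {arc_box I C | C. \<forall>j\<in>I. closed (C j)}"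
  then obtain C D where C: "\<forall>j\<in>I. closed (C j)" "A = arc_box I C" and D: "\<forall>j\<in>I. closed (D j)" "B = arc_box I D"
    by blast
  have "A \<inter> B = arc_box I (\<lambda>j. C j \<inter> D j)"
    by (auto simp: C D arc_box_def)
  then show "A \<inter> B \<in> {arc_box I C | C. \<forall>j\<in>I. closed (C j)}"
    using C D by (intro CollectI exI[of _ "\<lambda>j. C j \<inter> D j"]) auto
qed

text \<open>Continuous cutoffs that decrease to the indicator. \<open>C\<close> must be nonempty
  because \<open>infdist\<close> to the empty set is 0 by convention, which would make the limit 1
  everywhere.\<close>

lemma tendsto_infdist_cutoff:
  assumes "closed C" "C \<noteq> {}"
  shows "(\<lambda>n. max 0 (1 - real n * infdist z C)) \<longlonglongrightarrow> (if z \<in> C then 1 else 0)"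
proof (cases "z \<in> C")
  case False
  then have "infdist z C > 0"
    using assms infdist_pos_not_in_closed by blast
  then have "filterlim (\<lambda>n. real n * infdist z C) at_top sequentially"
    by (intro filterlim_at_top_mult_tendsto_pos[OF tendsto_const]) (auto intro: filterlim_real_sequentially)
  then have "\<forall>\<^sub>F n in sequentially. real n * infdist z C \<ge> 1"
    by (auto simp: filterlim_at_top)
  then have "\<forall>\<^sub>F n in sequentially. max 0 (1 - real n * infdist z C) = 0"
    by eventually_elim simp
  then show ?thesis
    using False by (simp add: tendsto_eventually)
qed simp

section \<open>Completeness of the characters on the torus\<close>

context
  fixes I :: "nat set"
  assumes fin: "finite I"
begin

interpretation bounded_orthonormal "TorOn I" "character I" "Freq I"
  by (rule bounded_orthonormal_character[OF fin])

lemma approximable_trig_poly: "p \<in> trig_poly I \<Longrightarrow> approximable p"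
  by (induction p rule: trig_poly.induct) (auto intro: approximable_e approximable_cmult approximable_add)

lemma approximable_unif_approximable:
  assumes h: "unif_approximable I h" and [measurable]: "h \<in> borel_measurable (TorOn I)"
  shows "approximable h"
proof -
  have "\<exists>p\<in>trig_poly I. \<forall>x. cmod (h x - p x) \<le> inverse (real (Suc n))" for n
    using h by (simp add: unif_approximable_def)
  then obtain p where p: "\<And>n. p n \<in> trig_poly I" "\<And>n x. cmod (h x - p n x) \<le> inverse (real (Suc n))"
    by metis
  obtain B where B: "\<And>x. cmod (h x) \<le> B"
    using unif_approximable_bounded[OF h] by blast
  show ?thesis
  \<comment> \<open>The envelope is \<open>B + 1\<close> because every uniform error 1/(n+1) is at
    most 1.\<close>
  proof (rule approximable_limit[of p h "\<lambda>_. B + 1"])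
    show "approximable (p n)" for n
      by (intro approximable_trig_poly p)
    show "(\<lambda>n. p n x) \<longlonglongrightarrow> h x" for x
    proof (rule LIM_zero_cancel, rule Lim_null_comparison[OF always_eventually LIMSEQ_inverse_real_of_nat])
      show "\<forall>n. norm (p n x - h x) \<le> inverse (real (Suc n))"
        using p(2) by (simp add: norm_minus_commute)
    qed
    show "cmod (p n x) \<le> B + 1" for n x
    proof -
      have "inverse (real (Suc n)) \<le> 1" by (simp add: field_simps)
      then show ?thesis
        using norm_triangle_ineq4[of "h x" "h x - p n x"] B[of x] p(2)[of x n] by simp
    qed
  qed auto
qed

lemma approximable_indicator_box:
  assumes C: "\<forall>j\<in>I. closed (C j)"
  shows "approximable (indicator (arc_box I C))"
proof (cases "\<exists>j\<in>I. C j = {}")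
  \<comment> \<open>An empty factor is treated apart: its cutoffs would converge to 1 although the
    box is empty.\<close>
  case True
  then have "arc_box I C = {}" by (auto simp: arc_box_def)
  then show ?thesis using approximable_0 by (simp add: indicator_def[abs_def])
next
  case False
  define \<phi> where "\<phi> n j z = max 0 (1 - real n * infdist z (C j))" for n j z
  define s where "s n x = (\<Prod>j\<in>I. complex_of_real (\<phi> n j (cis (2 * pi * x j))))" for n x
  have \<phi>_cont: "continuous_on S (\<phi> n j)" for n j S
    unfolding \<phi>_def[abs_def] by (intro continuous_intros)
  have \<phi>_le: "0 \<le> \<phi> n j z" "\<phi> n j z \<le> 1" for n j z
    by (auto simp: \<phi>_def infdist_nonneg)
  show ?thesis
  proof (rule approximable_limit[of s _ "\<lambda>_. 1"])
    fix n
    show "approximable (s n)"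
    proof (rule approximable_unif_approximable)
      show "unif_approximable I (s n)"
        unfolding s_def[abs_def] by (intro unif_approximable_prod unif_approximable_circle \<phi>_cont fin)
      show "s n \<in> borel_measurable (TorOn I)"
        unfolding s_def[abs_def]
      proof (rule borel_measurable_prod)
        fix j assume "j \<in> I"
        have "(\<lambda>t. complex_of_real (\<phi> n j (cis (2 * pi * t)))) \<in> borel_measurable borel"
          by (intro borel_measurable_continuous_onI continuous_intros
              continuous_on_compose2[OF \<phi>_cont[of UNIV]]) auto
        from measurable_compose[OF measurable_TorOn_component[OF \<open>j \<in> I\<close>] this]
        show "(\<lambda>x. complex_of_real (\<phi> n j (cis (2 * pi * x j)))) \<in> borel_measurable (TorOn I)" .
      qed
    qed
    show "cmod (s n x) \<le> 1" for x
      unfolding s_def prod_norm[symmetric] using \<phi>_le by (intro prod_le_1) auto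
  next
    have "arc_box I C \<in> sets (TorOn I)"
      unfolding sets_TorOn[OF fin] using C by (intro sigma_sets.Basic) blast
    then show "indicator (arc_box I C) \<in> borel_measurable (TorOn I)" by simp
  next
    fix x assume x: "x \<in> space (TorOn I)"
    have "(\<lambda>n. s n x) \<longlonglongrightarrow> (\<Prod>j\<in>I. complex_of_real (if cis (2 * pi * x j) \<in> C j then 1 else 0))"
      unfolding s_def \<phi>_def
      using C False by (intro tendsto_prod tendsto_of_real tendsto_infdist_cutoff) auto
    also have "(\<Prod>j\<in>I. complex_of_real (if cis (2 * pi * x j) \<in> C j then 1 else 0)) = indicator (arc_box I C) x"
      using x fin by (auto simp: arc_box_def indicator_def)
    finally show "(\<lambda>n. s n x) \<longlonglongrightarrow> indicator (arc_box I C) x" .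
  qed auto
qed

lemma parseval_torus:
  assumes "square_integrable (TorOn I) g"
  shows "((\<lambda>k. (cmod (\<integral>x. g x * cnj (character I k x) \<partial>TorOn I))\<^sup>2) has_sum
           (\<integral>x. (cmod (g x))\<^sup>2 \<partial>TorOn I)) (Freq I)"
proof -
  have "approximable g"
  proof (rule approximable_if_generator[OF Int_stable_boxes _ sets_TorOn[OF fin] _ _ assms])
    show "approximable (\<lambda>_. 1)" by (intro approximable_trig_poly trig_poly_const)
    show "{arc_box I C | C. \<forall>j\<in>I. closed (C j)} \<subseteq> Pow (space (TorOn I))"
      by (auto simp: arc_box_def)
  qed (auto intro: approximable_indicator_box)
  from parseval[OF this] show ?thesis by (simp add: coeff_def)
qed

end

subsection \<open>Fourier coefficients of ANOVA terms\<close>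

text \<open>Jensen's inequality, from Cauchy-Schwarz against the constant 1. The extended-valued
  right side admits non-integrable \<open>h\<close>, where the Bochner integral is 0, so all
  sections of an \<open>L2\<close> function can be treated alike without discarding a null
  set.\<close>

lemma (in prob_space) cmod_integral_squared_le_nn_integral:
  fixes h :: "'a \<Rightarrow> complex"
  assumes [measurable]: "h \<in> borel_measurable M"
  shows "ennreal ((cmod (\<integral>x. h x \<partial>M))\<^sup>2) \<le> (\<integral>\<^sup>+x. ennreal ((cmod (h x))\<^sup>2) \<partial>M)"
proof -
  have "ennreal (cmod (\<integral>x. h x \<partial>M)) \<le> (\<integral>\<^sup>+x. ennreal (cmod (h x)) \<partial>M)"
    by (cases "integrable M h") (auto simp: integral_norm_bound_ennreal not_integrable_integral_eq)
  then have "(ennreal (cmod (\<integral>x. h x \<partial>M)))\<^sup>2 \<le> (\<integral>\<^sup>+x. ennreal (cmod (h x)) * 1 \<partial>M)\<^sup>2"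
    by (intro power_mono) auto
  also have "\<dots> \<le> (\<integral>\<^sup>+x. (ennreal (cmod (h x)))\<^sup>2 \<partial>M) * (\<integral>\<^sup>+x. 1\<^sup>2 \<partial>M)"
    by (rule Cauchy_Schwarz_nn_integral) auto
  finally show ?thesis
    by (simp add: ennreal_power emeasure_space_1)
qed

lemma square_integrable_iff_nn_integral:
  "square_integrable M g \<longleftrightarrow> g \<in> borel_measurable M \<and> (\<integral>\<^sup>+x. ennreal ((cmod (g x))\<^sup>2) \<partial>M) < \<infinity>"
proof (cases "g \<in> borel_measurable M")
  case True
  then have "(\<lambda>x. (cmod (g x))\<^sup>2) \<in> borel_measurable M" by measurable
  with True show ?thesis
    by (simp add: square_integrable_def integrable_iff_bounded)
qed (simp add: square_integrable_def)

lemma finite_Dset: "finite (Dset d)"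
  by (simp add: Dset_def)

text \<open>The source of the independence of \<open>Proj d u g\<close> from the coordinates outside
  \<open>u\<close>.\<close>

lemma merge_merge_left: "I \<inter> J = {} \<Longrightarrow> merge I J (merge I J (x, z), y) = merge I J (x, y)"
  by (auto simp: merge_def fun_eq_iff)

lemma L2_iff: "g \<in> L2 d \<longleftrightarrow> square_integrable (Tor d) g"
  by (simp add: L2_def square_integrable_def)

lemma fourier_eq_integral_character:
  "fourier d g k = (\<integral>x. g x * cnj (character (Dset d) k x) \<partial>Tor d)"
proof -
  have "exp (- 2 * of_real pi * \<i> * of_real (\<Sum>j\<in>Dset d. of_int (k j) * x j))
      = cnj (character (Dset d) k x)" for x
  proof -
    have "character (Dset d) k x = (\<Prod>j\<in>Dset d. exp (\<i> * of_real (2 * pi * of_int (k j) * x j)))"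
      by (simp add: character_def cis_conv_exp)
    also have "\<dots> = exp (\<Sum>j\<in>Dset d. \<i> * of_real (2 * pi * of_int (k j) * x j))"
      by (simp add: exp_sum[OF finite_Dset])
    also have "(\<Sum>j\<in>Dset d. \<i> * of_real (2 * pi * of_int (k j) * x j))
        = 2 * of_real pi * \<i> * of_real (\<Sum>j\<in>Dset d. of_int (k j) * x j)"
      by (simp add: sum_distrib_left mult_ac)
    finally show ?thesis
      by (simp add: exp_cnj)
  qed
  then show ?thesis
    by (simp add: fourier_def)
qed

lemma Zd_eq_Freq: "Zd d = Freq (Dset d)"
  by (simp add: Zd_def Freq_def)

lemma fourier_diff:
  assumes "g \<in> L2 d" "h \<in> L2 d" "k \<in> Zd d"
  shows "fourier d (\<lambda>x. g x - h x) k = fourier d g k - fourier d h k"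
proof -
  interpret bounded_orthonormal "Tor d" "character (Dset d)" "Freq (Dset d)"
    by (rule bounded_orthonormal_character[OF finite_Dset])
  show ?thesis
    using coeff_diff[of g h k] assms
    by (simp add: fourier_eq_integral_character coeff_def L2_iff Zd_eq_Freq)
qed

lemma fourier_sum:
  assumes "\<And>i. i \<in> I \<Longrightarrow> h i \<in> L2 d" "k \<in> Zd d"
  shows "fourier d (\<lambda>x. \<Sum>i\<in>I. h i x) k = (\<Sum>i\<in>I. fourier d (h i) k)"
proof -
  interpret bounded_orthonormal "Tor d" "character (Dset d)" "Freq (Dset d)"
    by (rule bounded_orthonormal_character[OF finite_Dset])
  show ?thesis
    using coeff_sum[of I h k] assms
    by (simp add: fourier_eq_integral_character coeff_def L2_iff Zd_eq_Freq)
qed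

lemma fourier_cmult: "fourier d (\<lambda>x. a * g x) k = a * fourier d g k"
  by (simp add: fourier_def mult.assoc)

lemma L2_diff: "g \<in> L2 d \<Longrightarrow> h \<in> L2 d \<Longrightarrow> (\<lambda>x. g x - h x) \<in> L2 d"
  by (simp add: L2_iff square_integrable_diff)

lemma L2_sum: "(\<And>i. i \<in> I \<Longrightarrow> h i \<in> L2 d) \<Longrightarrow> (\<lambda>x. \<Sum>i\<in>I. h i x) \<in> L2 d"
  by (simp add: L2_iff square_integrable_sum)

lemma L2_cmult: "g \<in> L2 d \<Longrightarrow> (\<lambda>x. a * g x) \<in> L2 d"
  by (simp add: L2_iff square_integrable_cmult)

lemma L2norm_has_sum:
  assumes "g \<in> L2 d"
  shows "((\<lambda>k. (cmod (fourier d g k))\<^sup>2) has_sum (L2norm d g)\<^sup>2) (Zd d)"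
  using parseval_torus[OF finite_Dset, of d g] assms
  by (simp add: L2_iff Zd_eq_Freq L2norm_def fourier_eq_integral_character)

section \<open>Projections and their Fourier coefficients\<close>

context
  fixes d :: nat and u :: "nat set" and g :: "(nat \<Rightarrow> real) \<Rightarrow> complex"
  assumes u: "u \<subseteq> Dset d" and g: "g \<in> L2 d"
begin

text \<open>\<open>Proj\<close> is evaluated at full points \<open>x\<close> of the torus although
  only the coordinates in \<open>u\<close> enter, so \<open>x\<close> is restricted to
  \<open>u\<close> before the standard measurability of \<open>merge\<close> applies.\<close>

lemma merge_measurable_Tor:
  "(\<lambda>(x, y). merge u (Dset d - u) (x, y)) \<in> measurable (Tor d \<Otimes>\<^sub>M TorOn (Dset d - u)) (Tor d)"
proof -
  let ?M = "\<lambda>_::nat. unit_lborel"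
  have "(\<lambda>p. (restrict (fst p) u, snd p)) \<in> measurable (PiM (Dset d) ?M \<Otimes>\<^sub>M PiM (Dset d - u) ?M)
      (PiM u ?M \<Otimes>\<^sub>M PiM (Dset d - u) ?M)"
    by (intro measurable_Pair measurable_snd measurable_compose[OF measurable_fst measurable_restrict_subset] u)
  from measurable_compose[OF this measurable_merge] show ?thesis
    using u by (simp add: TorOn_def case_prod_unfold Un_absorb1)
qed

lemma g_merge_measurable:
  "(\<lambda>(x, y). g (merge u (Dset d - u) (x, y))) \<in> borel_measurable (Tor d \<Otimes>\<^sub>M TorOn (Dset d - u))"
  using measurable_compose[OF merge_measurable_Tor, of g borel] g
  by (simp add: L2_def case_prod_unfold)

lemma g_merge_measurable2:
  "x \<in> space (Tor d) \<Longrightarrow> (\<lambda>y. g (merge u (Dset d - u) (x, y))) \<in> borel_measurable (TorOn (Dset d - u))"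
  using measurable_compose[OF measurable_Pair1' g_merge_measurable] by simp

lemma Proj_merge: "Proj d u g (merge u (Dset d - u) (x, z)) = Proj d u g x"
  by (simp add: Proj_def merge_merge_left)

text \<open>Averaging contracts the L2 norm: Jensen on each fibre, then Tonelli over the
  fibres.\<close>

lemma Proj_L2: "Proj d u g \<in> L2 d"
proof -
  let ?v = "Dset d - u" and ?M = "\<lambda>_::nat. unit_lborel"
  interpret v: prob_space "TorOn ?v" by (rule prob_space_TorOn)
  interpret D: prob_space "Tor d" by (rule prob_space_TorOn)
  have fin: "finite u" "finite ?v" and un: "u \<union> ?v = Dset d"
    using u finite_Dset finite_subset by auto
  have g2: "(\<lambda>x. ennreal ((cmod (g x))\<^sup>2)) \<in> borel_measurable (Tor d)"
  proof -
    have [measurable]: "g \<in> borel_measurable (Tor d)" using g by (simp add: L2_def)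
    show ?thesis by measurable
  qed
  define F where "F x = (\<integral>\<^sup>+y. ennreal ((cmod (g (merge u ?v (x, y))))\<^sup>2) \<partial>TorOn ?v)" for x
  have "(\<lambda>(x, y). ennreal ((cmod (g (merge u ?v (x, y))))\<^sup>2)) \<in> borel_measurable (Tor d \<Otimes>\<^sub>M TorOn ?v)"
    using measurable_compose[OF merge_measurable_Tor g2] by (simp add: case_prod_unfold)
  then have F: "F \<in> borel_measurable (Tor d)"
    unfolding F_def[abs_def] by (rule v.borel_measurable_nn_integral)
  have "(\<integral>\<^sup>+x. ennreal ((cmod (Proj d u g x))\<^sup>2) \<partial>Tor d) \<le> (\<integral>\<^sup>+x. F x \<partial>Tor d)"
    unfolding Proj_def F_def
    by (intro nn_integral_mono v.cmod_integral_squared_le_nn_integral g_merge_measurable2)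
  \<comment> \<open>\<open>F\<close> depends only on the coordinates in \<open>u\<close>: after
    splitting the torus, the integral over the others has a constant integrand and total mass 1. A
    second splitting, read backwards, reassembles the norm of \<open>g\<close>.\<close>
  also have "\<dots> = (\<integral>\<^sup>+x. (\<integral>\<^sup>+z. F (merge u ?v (x, z)) \<partial>TorOn ?v) \<partial>TorOn u)"
    using torus.product_nn_integral_fold[of u ?v F] fin F by (simp add: Un_absorb1[OF u] TorOn_def)
  also have "\<dots> = (\<integral>\<^sup>+x. F x \<partial>TorOn u)"
    unfolding F_def by (simp add: merge_merge_left v.emeasure_space_1)
  also have "\<dots> = (\<integral>\<^sup>+x. ennreal ((cmod (g x))\<^sup>2) \<partial>Tor d)"
    using torus.product_nn_integral_fold[of u ?v "\<lambda>x. ennreal ((cmod (g x))\<^sup>2)"] fin g2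
    by (simp add: Un_absorb1[OF u] TorOn_def F_def)
  also have "\<dots> < \<infinity>"
    using g by (simp add: L2_iff square_integrable_iff_nn_integral)
  finally have "(\<integral>\<^sup>+x. ennreal ((cmod (Proj d u g x))\<^sup>2) \<partial>Tor d) < \<infinity>" .
  moreover have "Proj d u g \<in> borel_measurable (Tor d)"
    unfolding Proj_def[abs_def] by (rule v.borel_measurable_lebesgue_integral[OF g_merge_measurable])
  ultimately show ?thesis
    by (simp add: L2_iff square_integrable_iff_nn_integral)
qed

text \<open>The character splits over \<open>u\<close> and its complement. \<open>Proj d u g\<close>
  is constant in the complementary coordinates, so the second factor integrates to 0 unless
  \<open>k\<close> vanishes there; in that case this factor is 1 and Fubini returns the coefficient
  of \<open>g\<close>.\<close>

lemma fourier_Proj: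
  assumes k: "k \<in> Zd d"
  shows "fourier d (Proj d u g) k = (if \<forall>j\<in>Dset d - u. k j = 0 then fourier d g k else 0)"
proof -
  let ?v = "Dset d - u"
  interpret bounded_orthonormal "Tor d" "character (Dset d)" "Freq (Dset d)"
    by (rule bounded_orthonormal_character[OF finite_Dset])
  have fin: "finite u" "finite ?v" and un: "u \<union> ?v = Dset d"
    using u finite_Dset finite_subset by auto
  have split: "character (Dset d) k (merge u ?v (x, z)) = character u k x * character ?v k z" for x z
  proof -
    have "character (Dset d) k (merge u ?v (x, z))
        = (\<Prod>j\<in>u. cis (2 * pi * of_int (k j) * merge u ?v (x, z) j))
        * (\<Prod>j\<in>?v. cis (2 * pi * of_int (k j) * merge u ?v (x, z) j))"
      unfolding character_def by (subst prod.subset_diff[OF u finite_Dset]) (rule mult.commute)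
    also have "\<dots> = character u k x * character ?v k z"
      unfolding character_def by (intro arg_cong2[where f = "(*)"] prod.cong) auto
    finally show ?thesis .
  qed
  have fold: "fourier d h k = (\<integral>x. (\<integral>y. h (merge u ?v (x, y)) * cnj (character u k x * character ?v k y)
      \<partial>TorOn ?v) \<partial>TorOn u)" if h: "h \<in> L2 d" for h
  proof -
    have "integrable (Tor d) (\<lambda>x. h x * cnj (character (Dset d) k x))"
      using h k by (intro integrable_coeff) (simp_all add: L2_iff Zd_eq_Freq)
    then have "(\<integral>x. h x * cnj (character (Dset d) k x) \<partial>Tor d)
        = (\<integral>x. (\<integral>y. h (merge u ?v (x, y)) * cnj (character (Dset d) k (merge u ?v (x, y)))
            \<partial>TorOn ?v) \<partial>TorOn u)"
      using torus.product_integral_fold[of u ?v "\<lambda>x. h x * cnj (character (Dset d) k x)"] fin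
      by (simp add: Un_absorb1[OF u] TorOn_def)
    then show ?thesis
      by (simp only: fourier_eq_integral_character split)
  qed
  have "fourier d (Proj d u g) k
      = (\<integral>x. (\<integral>y. (Proj d u g x * cnj (character u k x)) * cnj (character ?v k y) \<partial>TorOn ?v) \<partial>TorOn u)"
    by (simp add: fold[OF Proj_L2] Proj_merge mult.assoc)
  also have "\<dots> = (\<integral>x. (Proj d u g x * cnj (character u k x))
      * cnj (\<integral>y. character ?v k y \<partial>TorOn ?v) \<partial>TorOn u)"
    by (simp only: integral_mult_right_zero Bochner_Integration.integral_cnj)
  also have "\<dots> = (if \<forall>j\<in>?v. k j = 0 then \<integral>x. Proj d u g x * cnj (character u k x) \<partial>TorOn u else 0)"
    unfolding integral_character[OF fin(2)] by simp
  also have "\<dots> = (if \<forall>j\<in>?v. k j = 0 then fourier d g k else 0)"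
  proof (rule if_cong[OF refl _ refl])
    assume "\<forall>j\<in>?v. k j = 0"
    then have "character ?v k y = 1" for y
      by (simp add: character_def)
    then show "(\<integral>x. Proj d u g x * cnj (character u k x) \<partial>TorOn u) = fourier d g k"
      by (simp add: fold[OF g] Proj_def)
  qed
  finally show ?thesis .
qed

end

section \<open>ANOVA terms as blocks of frequencies\<close>

definition supp :: "(nat \<Rightarrow> int) \<Rightarrow> nat set" where
  "supp k = {j. k j \<noteq> 0}"

lemma supp_subset_Dset: "k \<in> Zd d \<Longrightarrow> supp k \<subseteq> Dset d"
  by (auto simp: supp_def Zd_def)

declare anova.simps [simp del]

lemma anova_eq:
  "u \<subseteq> Dset d \<Longrightarrow> anova d g u = (\<lambda>x. Proj d u g x - (\<Sum>v\<in>{v. v \<subset> u}. anova d g v x))"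
  using anova.simps[of d g u] finite_subset[OF _ finite_Dset] by (auto simp: fun_eq_iff)

lemma anova_L2:
  assumes g: "g \<in> L2 d"
  shows "u \<subseteq> Dset d \<Longrightarrow> anova d g u \<in> L2 d"
proof (induction "card u" arbitrary: u rule: less_induct)
  case less
  have "anova d g v \<in> L2 d" if "v \<subset> u" for v
    using less that psubset_card_mono[of u v] finite_subset[OF less.prems finite_Dset] by blast
  then show ?case
    unfolding anova_eq[OF less.prems] by (intro L2_diff L2_sum Proj_L2 less.prems g) auto
qed

text \<open>The projection keeps the frequencies with support inside \<open>u\<close>. By induction
  the subtracted terms remove those with support strictly inside, each exactly once, because only
  \<open>v = supp k\<close> can contribute.\<close>

lemma fourier_anova:
  assumes g: "g \<in> L2 d" and k: "k \<in> Zd d"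
  shows "u \<subseteq> Dset d \<Longrightarrow> fourier d (anova d g u) k = (if supp k = u then fourier d g k else 0)"
proof (induction "card u" arbitrary: u rule: less_induct)
  case less
  note u = less.prems
  have fin: "finite u" by (rule finite_subset[OF u finite_Dset])
  have sub: "v \<subseteq> Dset d" if "v \<subset> u" for v using u that by blast
  have IH: "fourier d (anova d g v) k = (if supp k = v then fourier d g k else 0)" if "v \<subset> u" for v
    using less.hyps[OF psubset_card_mono[OF fin that] sub[OF that]] .
  have "fourier d (anova d g u) k = fourier d (Proj d u g) k - (\<Sum>v\<in>{v. v \<subset> u}. fourier d (anova d g v) k)"
  proof -
    have L2: "anova d g v \<in> L2 d" if "v \<in> {v. v \<subset> u}" for v
      using that by (intro anova_L2[OF g] sub) simp
    show ?thesis
      unfolding anova_eq[OF u]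
      by (subst fourier_diff[OF Proj_L2[OF u g] L2_sum[of "{v. v \<subset> u}" "anova d g", OF L2] k], assumption)
        (subst fourier_sum[OF L2 k], auto)
  qed
  also have "fourier d (Proj d u g) k = (if supp k \<subseteq> u then fourier d g k else 0)"
  proof -
    have "(\<forall>j\<in>Dset d - u. k j = 0) \<longleftrightarrow> supp k \<subseteq> u"
      using k by (auto simp: supp_def Zd_def)
    then show ?thesis by (simp add: fourier_Proj[OF u g k])
  qed
  also have "(\<Sum>v\<in>{v. v \<subset> u}. fourier d (anova d g v) k)
      = (\<Sum>v\<in>{v. v \<subset> u}. if supp k = v then fourier d g k else 0)"
    using IH by (intro sum.cong) auto
  also have "\<dots> = (if supp k \<subset> u then fourier d g k else 0)"
  proof -
    have "finite {v. v \<subset> u}"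
      using fin by (rule finite_subset[OF _ finite_Pow_iff[THEN iffD2], rotated]) auto
    then show ?thesis by simp
  qed
  finally show ?case by auto
qed

subsection \<open>Truncation error\<close>

text \<open>The squared norm of the ANOVA term of \<open>u\<close> (see
  \<open>L2norm_anova\<close>), taken directly from the coefficients of \<open>g\<close> so that the
  recursion no longer appears.\<close>

definition energy :: "nat \<Rightarrow> ((nat \<Rightarrow> real) \<Rightarrow> complex) \<Rightarrow> nat set \<Rightarrow> real" where
  "energy d g u = (\<Sum>\<^sub>\<infinity>k\<in>{k \<in> Zd d. supp k = u}. (cmod (fourier d g k))\<^sup>2)"

lemma energy_nonneg: "0 \<le> energy d g u"
  unfolding energy_def by (intro infsum_nonneg) simp

lemma fourier_squares_summable:
  assumes "g \<in> L2 d" "K \<subseteq> Zd d"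
  shows "(\<lambda>k. (cmod (fourier d g k))\<^sup>2) summable_on K"
  using has_sum_imp_summable[OF L2norm_has_sum[OF assms(1)]] assms(2)
  by (rule summable_on_subset_banach)

text \<open>Supports partition the frequencies into finitely many classes, so Parseval for a
  spectral truncation \<open>h\<close> of \<open>g\<close> becomes a finite sum. It is applied to
  single terms, to \<open>g\<close> itself and to the truncation error.\<close>

lemma L2norm_squared_spectral:
  assumes g: "g \<in> L2 d" and h: "h \<in> L2 d" and V: "V \<subseteq> Pow (Dset d)"
    and eq: "\<And>k. k \<in> Zd d \<Longrightarrow> fourier d h k = (if supp k \<in> V then fourier d g k else 0)"
  shows "(L2norm d h)\<^sup>2 = (\<Sum>u\<in>V. energy d g u)"
proof -
  have "(L2norm d h)\<^sup>2 = (\<Sum>\<^sub>\<infinity>k\<in>Zd d. (cmod (fourier d h k))\<^sup>2)"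
    using L2norm_has_sum[OF h] by (simp add: infsumI)
  also have "\<dots> = (\<Sum>\<^sub>\<infinity>k\<in>(\<Union>u\<in>V. {k \<in> Zd d. supp k = u}). (cmod (fourier d g k))\<^sup>2)"
    by (rule infsum_cong_neutral) (auto simp: eq)
  also have "\<dots> = (\<Sum>u\<in>V. energy d g u)"
    unfolding energy_def using V finite_subset[OF V] finite_Dset
    by (intro sum_infsum[symmetric] fourier_squares_summable g) auto
  finally show ?thesis .
qed

lemma L2norm_anova:
  assumes "g \<in> L2 d" "u \<subseteq> Dset d"
  shows "(L2norm d (anova d g u))\<^sup>2 = energy d g u"
  using L2norm_squared_spectral[OF assms(1) anova_L2[OF assms], of "{u}"] assms
  by (simp add: fourier_anova)

lemma L2norm_eq_sum_energy:
  "g \<in> L2 d \<Longrightarrow> (L2norm d g)\<^sup>2 = (\<Sum>u\<in>Pow (Dset d). energy d g u)"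
  by (rule L2norm_squared_spectral) (auto dest: supp_subset_Dset)

lemma energy_empty: "energy d g {} = (cmod (fourier d g (\<lambda>_. 0)))\<^sup>2"
proof -
  have "{k \<in> Zd d. supp k = {}} = {\<lambda>_. 0}"
    by (auto simp: supp_def Zd_def)
  then show ?thesis by (simp add: energy_def)
qed

lemma variance_eq_sum_energy:
  assumes "g \<in> L2 d"
  shows "variance d g = (\<Sum>u\<in>Pow (Dset d) - {{}}. energy d g u)"
  unfolding variance_def L2norm_eq_sum_energy[OF assms] energy_empty[symmetric]
  by (subst sum.remove[of _ "{}"]) (auto simp: finite_Dset)

text \<open>For the empty set the frequency 0 would survive, and the variance would be 0 instead of
  the energy.\<close>

lemma variance_anova:
  assumes "g \<in> L2 d" "u \<subseteq> Dset d" "u \<noteq> {}"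
  shows "variance d (anova d g u) = energy d g u"
proof -
  have "(\<lambda>_. 0) \<in> Zd d" "supp (\<lambda>_. 0) = {}"
    by (auto simp: Zd_def supp_def)
  then show ?thesis
    using assms by (simp add: variance_def L2norm_anova fourier_anova)
qed

lemma L2norm_diff_TU:
  assumes g: "g \<in> L2 d" and U: "U \<subseteq> Pow (Dset d)"
  shows "(L2norm d (\<lambda>x. g x - TU d U g x))\<^sup>2 = (\<Sum>u\<in>Pow (Dset d) - U. energy d g u)"
proof (rule L2norm_squared_spectral[OF g])
  have L2: "anova d g u \<in> L2 d" if "u \<in> U" for u
    using that U by (intro anova_L2[OF g]) auto
  have T: "TU d U g \<in> L2 d"
    unfolding TU_def[abs_def] by (intro L2_sum L2)
  then show "(\<lambda>x. g x - TU d U g x) \<in> L2 d"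
    by (rule L2_diff[OF g])
  fix k assume k: "k \<in> Zd d"
  have "fourier d (TU d U g) k = (\<Sum>u\<in>U. fourier d (anova d g u) k)"
    unfolding TU_def[abs_def] by (rule fourier_sum[OF L2 k])
  also have "\<dots> = (\<Sum>u\<in>U. if supp k = u then fourier d g k else 0)"
    using U by (intro sum.cong fourier_anova[OF g k]) auto
  also have "\<dots> = (if supp k \<in> U then fourier d g k else 0)"
    using finite_subset[OF U] finite_Dset by simp
  finally show "fourier d (\<lambda>x. g x - TU d U g x) k
      = (if supp k \<in> Pow (Dset d) - U then fourier d g k else 0)"
    using supp_subset_Dset[OF k] by (simp add: fourier_diff[OF g T k])
qed auto

section \<open>Comparison with the weighted norm\<close>

lemma Hw_L2: "g \<in> Hw d w \<Longrightarrow> g \<in> L2 d"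
  by (simp add: Hw_def)

lemma Hnorm_squared: "(Hnorm d w g)\<^sup>2 = (\<Sum>\<^sub>\<infinity>k\<in>Zd d. (w k)\<^sup>2 * (cmod (fourier d g k))\<^sup>2)"
  unfolding Hnorm_def by (intro real_sqrt_pow2 infsum_nonneg) simp

lemma Hnorm_nonneg: "0 \<le> Hnorm d w g"
  unfolding Hnorm_def by (intro real_sqrt_ge_zero infsum_nonneg) simp

lemma L2norm_le_Hnorm:
  assumes w: "\<forall>k\<in>Zd d. w k \<ge> 1" and g: "g \<in> Hw d w"
  shows "(L2norm d g)\<^sup>2 \<le> (Hnorm d w g)\<^sup>2"
proof -
  have "(L2norm d g)\<^sup>2 = (\<Sum>\<^sub>\<infinity>k\<in>Zd d. (cmod (fourier d g k))\<^sup>2)"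
    using L2norm_has_sum[OF Hw_L2[OF g]] by (simp add: infsumI)
  also have "\<dots> \<le> (\<Sum>\<^sub>\<infinity>k\<in>Zd d. (w k)\<^sup>2 * (cmod (fourier d g k))\<^sup>2)"
  proof (rule infsum_mono)
    fix k assume "k \<in> Zd d"
    then have "1 \<le> (w k)\<^sup>2" using w by (simp add: one_le_power)
    then show "(cmod (fourier d g k))\<^sup>2 \<le> (w k)\<^sup>2 * (cmod (fourier d g k))\<^sup>2"
      by (simp add: mult_le_cancel_right1)
  qed (use g in \<open>auto simp: Hw_def intro: fourier_squares_summable\<close>)
  finally show ?thesis by (simp add: Hnorm_squared)
qed

lemma Hw_cmult:
  assumes "g \<in> Hw d w"
  shows "(\<lambda>x. a * g x) \<in> Hw d w"
proof -
  have "(\<lambda>k. (cmod a)\<^sup>2 * ((w k)\<^sup>2 * (cmod (fourier d g k))\<^sup>2)) summable_on Zd d"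
    using assms by (intro summable_on_cmult_right) (simp add: Hw_def)
  then show ?thesis
    using assms by (simp add: Hw_def L2_cmult fourier_cmult norm_mult power_mult_distrib mult_ac)
qed

lemma Hnorm_cmult: "Hnorm d w (\<lambda>x. a * g x) = cmod a * Hnorm d w g"
proof (rule power2_eq_imp_eq)
  show "(Hnorm d w (\<lambda>x. a * g x))\<^sup>2 = (cmod a * Hnorm d w g)\<^sup>2"
    unfolding power_mult_distrib Hnorm_squared infsum_cmult_right'[symmetric]
    by (intro infsum_cong) (simp add: fourier_cmult norm_mult power_mult_distrib)
qed (auto simp: Hnorm_nonneg)

lemma energy_cmult: "energy d (\<lambda>x. a * g x) u = (cmod a)\<^sup>2 * energy d g u"
  unfolding energy_def infsum_cmult_right'[symmetric]
  by (intro infsum_cong) (simp add: fourier_cmult norm_mult power_mult_distrib)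

lemma zero_in_Hw: "(\<lambda>_. 0) \<in> Hw d w" and Hnorm_zero: "Hnorm d w (\<lambda>_. 0) = 0"
  by (auto simp: Hw_def L2_def Hnorm_def fourier_def)

text \<open>Parseval bounds the sets whose suprema occur in \<open>dsup\<close>, so these suprema are not junk values; the
  \<open>LEAST\<close> is attained because the tail sum is empty at \<open>s = d\<close>.\<close>
lemma high_order_energy_le:
  assumes d: "d \<ge> 1" and w: "\<forall>k\<in>Zd d. w k \<ge> 1" and \<delta>: "\<delta> < 1"
    and f: "f \<in> Hw d w" and pos: "Hnorm d w f > 0"
  shows "(\<Sum>u\<in>{u. u \<subseteq> Dset d \<and> card u > dsup d w \<delta>}. energy d f u) \<le> (1 - \<delta>) * (Hnorm d w f)\<^sup>2"
proof -
  define tails where "tails s = {(\<Sum>u\<in>{u. u \<subseteq> Dset d \<and> card u > s}. (L2norm d (anova d g u))\<^sup>2) | g.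
            g \<in> Hw d w \<and> Hnorm d w g \<le> 1}" for s
  have tail: "(\<Sum>u\<in>{u. u \<subseteq> Dset d \<and> card u > s}. (L2norm d (anova d g u))\<^sup>2)
      = (\<Sum>u\<in>{u. u \<subseteq> Dset d \<and> card u > s}. energy d g u)" if "g \<in> Hw d w" for g s
    using that by (intro sum.cong) (auto simp: L2norm_anova Hw_L2)
  have "{u. u \<subseteq> Dset d \<and> card u > d} = {}"
    using card_mono[OF finite_Dset] by (auto simp: Dset_def not_less)
  then have "tails d = {0 | g. g \<in> Hw d w \<and> Hnorm d w g \<le> 1}"
    unfolding tails_def by (simp only: sum.empty)
  \<comment> \<open>The zero function keeps the set of tails nonempty; \<open>Sup {}\<close> would
    carry no usable value.\<close>
  moreover have "\<exists>g. g \<in> Hw d w \<and> Hnorm d w g \<le> 1"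
    using zero_in_Hw[of d w] Hnorm_zero[of d w] by (intro exI[of _ "\<lambda>_. 0"]) simp
  ultimately have "tails d = {0}" by auto
  then have "d \<in> Dset d \<and> Sup (tails d) \<le> 1 - \<delta>"
    using d \<delta> by (simp add: Dset_def)
  then have Sup: "Sup (tails (dsup d w \<delta>)) \<le> 1 - \<delta>"
    unfolding tails_def dsup_def by (rule LeastI2) auto
  have "bdd_above (tails s)" for s
  proof (rule bdd_aboveI[where M = 1])
    fix t assume "t \<in> tails s"
    then obtain g where g: "g \<in> Hw d w" "Hnorm d w g \<le> 1"
      and t: "t = (\<Sum>u\<in>{u. u \<subseteq> Dset d \<and> card u > s}. energy d g u)"
      using tail unfolding tails_def by auto
    have "t \<le> (\<Sum>u\<in>Pow (Dset d). energy d g u)"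
      unfolding t by (intro sum_mono2) (auto simp: finite_Dset energy_nonneg)
    also have "\<dots> \<le> (Hnorm d w g)\<^sup>2"
      using L2norm_le_Hnorm[OF w g(1)] by (simp add: L2norm_eq_sum_energy[OF Hw_L2[OF g(1)]])
    also have "\<dots> \<le> 1"
      using g(2) by (simp add: power_le_one Hnorm_nonneg)
    finally show "t \<le> 1" .
  qed
  define g where "g x = of_real (1 / Hnorm d w f) * f x" for x
  have g: "g \<in> Hw d w" unfolding g_def[abs_def] by (rule Hw_cmult[OF f])
  have "Hnorm d w g = 1"
    unfolding g_def[abs_def] Hnorm_cmult using pos by (simp add: norm_divide)
  then have "(\<Sum>u\<in>{u. u \<subseteq> Dset d \<and> card u > dsup d w \<delta>}. energy d g u) \<in> tails (dsup d w \<delta>)"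
    unfolding tails_def tail[OF g, symmetric] using g by auto
  then have "(\<Sum>u\<in>{u. u \<subseteq> Dset d \<and> card u > dsup d w \<delta>}. energy d g u) \<le> 1 - \<delta>"
    using cSup_upper[OF _ \<open>bdd_above (tails (dsup d w \<delta>))\<close>] Sup by fastforce
  also have "(\<Sum>u\<in>{u. u \<subseteq> Dset d \<and> card u > dsup d w \<delta>}. energy d g u)
      = (\<Sum>u\<in>{u. u \<subseteq> Dset d \<and> card u > dsup d w \<delta>}. energy d f u) / (Hnorm d w f)\<^sup>2"
    unfolding g_def[abs_def] energy_cmult sum_divide_distrib
    using pos by (intro sum.cong) (auto simp: norm_divide power_divide)
  finally show ?thesis
    using pos by (simp add: divide_le_eq)
qed

text \<open>The case \<open>u = {}\<close> is excluded because its index is 0 whatever its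
  energy.\<close>

lemma energy_le_of_gsi:
  assumes w: "\<forall>k\<in>Zd d. w k \<ge> 1" and f: "f \<in> Hw d w" and u: "u \<subseteq> Dset d" "u \<noteq> {}"
    and gsi: "gsi d u f < \<epsilon>" and \<epsilon>: "\<epsilon> > 0"
  shows "energy d f u \<le> \<epsilon> * (Hnorm d w f)\<^sup>2"
proof -
  note L2 = Hw_L2[OF f]
  have le: "energy d f u \<le> variance d f"
    unfolding variance_eq_sum_energy[OF L2] using u
    by (intro member_le_sum) (auto simp: energy_nonneg finite_Dset)
  have "energy d f u \<le> \<epsilon> * variance d f"
  proof (cases "variance d f = 0")
    case False
    then have "variance d f > 0" using le energy_nonneg[of d f u] by linarith
    then show ?thesis
      using gsi by (simp add: gsi_def variance_anova[OF L2 u] divide_less_eq)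
  \<comment> \<open>With zero variance \<open>gsi\<close> is a division by zero and says nothing,
    but \<open>le\<close> already bounds the energy by 0.\<close>
  qed (use le in simp)
  also have "\<dots> \<le> \<epsilon> * (Hnorm d w f)\<^sup>2"
    using \<epsilon> L2norm_le_Hnorm[OF w f] by (intro mult_left_mono) (auto simp: variance_def intro: order.trans[rotated])
  finally show ?thesis .
qed

theorem theorem6p1:
  fixes d :: nat and w :: "(nat \<Rightarrow> int) \<Rightarrow> real" and \<delta> \<epsilon> :: real
    and f :: "(nat \<Rightarrow> real) \<Rightarrow> complex" and U :: "nat set set"
  assumes "d \<ge> 1"
    and "\<forall>k\<in>Zd d. w k \<ge> 1"
    and "0 < \<delta>" and "\<delta> < 1"
    and "f \<in> Hw d w"
    and "anova_subset d U" and "U \<noteq> {}"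
    and "U \<subseteq> Us d (dsup d w \<delta>)"
    and "\<epsilon> > 0"
    and "\<forall>u\<in>Us d (dsup d w \<delta>) - U. gsi d u f < \<epsilon>"
  shows "L2norm d (\<lambda>x. f x - TU d U f x) / Hnorm d w f
           \<le> sqrt (1 - \<delta>) + sqrt (real (card (Us d (dsup d w \<delta>) - U)) * \<epsilon>)"
proof (cases "Hnorm d w f = 0")
  case True
  \<comment> \<open>Division by zero makes the left side 0.\<close>
  then show ?thesis using assms by simp
next
  case False
  define H where "H = Hnorm d w f"
  have H: "H > 0" using False Hnorm_nonneg[of d w f] by (simp add: H_def)
  define s where "s = dsup d w \<delta>"
  define low where "low = Us d s - U"
  define high where "high = {u. u \<subseteq> Dset d \<and> card u > s}"
  \<comment> \<open>A nonempty family closed under subsets contains \<open>{}\<close>, so every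
    omitted low-order term has a nonempty index set and its sensitivity index controls its
    energy.\<close>
  have U: "U \<subseteq> Pow (Dset d)" and "{} \<in> U"
    using assms(6,7) unfolding anova_subset_def by auto
  have fin: "finite low" "finite high"
    unfolding low_def high_def Us_def by (auto simp: finite_Dset)
  \<comment> \<open>Sets of more than \<open>s\<close> elements all lie outside \<open>U\<close>, by
    the assumed inclusion, so the omitted terms are exactly these two disjoint groups.\<close>
  have "Pow (Dset d) - U = low \<union> high" "low \<inter> high = {}"
    using U assms(8) unfolding low_def high_def Us_def s_def by auto
  then have "(L2norm d (\<lambda>x. f x - TU d U f x))\<^sup>2 = (\<Sum>u\<in>low. energy d f u) + (\<Sum>u\<in>high. energy d f u)"
    using fin by (simp add: L2norm_diff_TU[OF Hw_L2[OF assms(5)] U] sum.union_disjoint)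
  also have "(\<Sum>u\<in>low. energy d f u) \<le> (\<Sum>u\<in>low. \<epsilon> * H\<^sup>2)"
  proof (rule sum_mono)
    fix u assume u: "u \<in> low"
    then have "u \<subseteq> Dset d" "u \<noteq> {}" "gsi d u f < \<epsilon>"
      using \<open>{} \<in> U\<close> assms(10) by (auto simp: low_def s_def Us_def)
    then show "energy d f u \<le> \<epsilon> * H\<^sup>2"
      unfolding H_def by (rule energy_le_of_gsi[OF assms(2,5) _ _ _ assms(9)])
  qed
  also have "(\<Sum>u\<in>high. energy d f u) \<le> (1 - \<delta>) * H\<^sup>2"
    unfolding high_def s_def H_def using high_order_energy_le[OF assms(1,2,4,5)] H by (simp add: H_def)
  finally have "(L2norm d (\<lambda>x. f x - TU d U f x))\<^sup>2 \<le> ((1 - \<delta>) + real (card low) * \<epsilon>) * H\<^sup>2"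
    by (simp add: algebra_simps)
  then have "(L2norm d (\<lambda>x. f x - TU d U f x) / H)\<^sup>2 \<le> (1 - \<delta>) + real (card low) * \<epsilon>"
    using H by (simp add: power_divide divide_le_eq)
  then have "L2norm d (\<lambda>x. f x - TU d U f x) / H \<le> sqrt ((1 - \<delta>) + real (card low) * \<epsilon>)"
    by (rule real_le_rsqrt)
  also have "\<dots> \<le> sqrt (1 - \<delta>) + sqrt (real (card low) * \<epsilon>)"
    using assms(4,9) by (intro sqrt_add_le_add_sqrt) auto
  finally show ?thesis
    by (simp add: H_def low_def s_def)
qed

end
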